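(* Let $\{m_k^a\}_{k=1}^\infty$ and $\{m_k^b\}_{k=1}^\infty$ be two moment sequences with $m^a_k=m^b_k=0$ for all odd $k$. When $\gamma\to0$ and $q\gamma\to\infty$, the $q$-$\gamma$ convolution of $\{m_k^a\}_{k=1}^\infty$ and $\{m_k^b\}_{k=1}^\infty$ converges to the usual convolution of the two corresponding independent random variables, and the $q$-$\gamma$ cumulants of $\{m_{2k}^a\}_{k=1}^\infty$, $\{m_{2k}^b\}_{k=1}^\infty$ converge to the usual cumulants after proper rescaling. Similarly, when $q\ge 1$ is fixed and $\gamma\to\infty$, the $q$-$\gamma$ convolution converges to the rectangular free convolution, and the $q$-$\gamma$ cumulants converge to the rectangular free cumulants after proper rescaling.
   Context: Throughout $q\ge1$, $\gamma>0$. $q$-$\gamma$ cumulants. On formal power series $\mathbb{R}[[z]]$ define linear operators: $\partial(z^n)=nz^{n-1}$; $d(z^n)=z^{n-1}$ for $n\ge1$ and $d(1)=0$; $d'(z^n)=2z^{n-1}$ for odd $n$ and $0$ for even $n$; $*_g$ is multiplication by $g(z)$; $[z^0]$ takes the constant term. The map $\mathrm{T}^{q,\gamma}_{\kappa\to m}$ sends a real sequence $\{\kappa_l\}_{l\ge1}$ with $\kappa_l=0$ for odd $l$ to $\{m_{2k}\}_{k\ge1}$, where, with $g(z)=\sum_{l\ge1}\kappa_lz^{l-1}$, $$m_{2k}=[z^0]\bigl(\partial+2\gamma d+((q-1)\gamma-\tfrac12)d'+*_g\bigr)^{2k-1}g(z).$$ This map is invertible, and the sequence $\{\kappa_l\}$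 with vanishing odd entries corresponding to $\{m_{2k}\}$ is called the sequence of $q$-$\gamma$ cumulants of $\{m_{2k}\}$. $q$-$\gamma$ convolution. It is the binary operation $\boxplus_{q,\gamma}$ on moment sequences with vanishing odd entries that describes the limit of sums of $N\times M$ rectangular $\beta$-random matrices as $N,M\to\infty$, $\theta=\beta/2\to0$, $N\theta\to\gamma$, $M\theta\to q\gamma$; it is characterized by the fact that the $q$-$\gamma$ cumulants of the even moments of $\{m_k^a\}\boxplus_{q,\gamma}\{m_k^b\}$ are the sums of the corresponding $q$-$\gamma$ cumulants of $\{m_{2k}^a\}$ and $\{m_{2k}^b\}$ (and its odd entries are $0$). Usual convolution and cumulants. The random variable corresponding to $\{m_k\}$ is the one (on $\mathbb{R}_{\ge0}$) whose $k$-th moment is $m_{2k}$; the usual cumulants $\{\kappa'_l\}$ are those of this variable, given by $m_{2k}=\sum_{\pi}\prod_{B\in\pi}\kappa'_{|B|}$, the sum being over all set partitions $\pi$ of $\{1,\dots,k\}$. Rectangular free convolution and cumulants. For $q\ge1$, the rectangular free cumulants $\{c^q_l\}_{l\ge1}$ of a symmetric moment sequence (odd moments $0$) are defined by $c^q_l=0$ for odd $l$ and $m_{2k}=\sum_{\pi}q^{-e(\pi)}\prod_{B\in\pi}c^q_{|B|}$ for $k\ge1$, where $\pi$ ranges over non-crossing partitions of $\{1,\dots,2k\}$ with all blocks of even size and $e(\pi)$ is the number of blocks $B$ with $\min(B)$ even. The rectangular free convolution (with parameter $q$) of two symmetric probability measures with moments $\{m^a_k\}$, $\{m^b_k\}$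 is the operation that adds rectangular free cumulants. "After proper rescaling" means after multiplying each $q$-$\gamma$ cumulant by a suitable factor depending only on its index, $q$ and $\gamma$ (in the first limit, the rescaled $2l$-th $q$-$\gamma$ cumulant is compared with the $l$-th usual cumulant). *)

theory Defs
  imports
    "HOL-Computational_Algebra.Formal_Power_Series"
    "HOL-Library.Disjoint_Sets"
    "HOL-Probability.Probability"
begin

text \<open>
  A sequence indexed by \<open>l \<ge> 1\<close> is a function on \<open>nat\<close> with a normalised value at \<open>0\<close>:
  \<open>1\<close> for moment sequences (the total mass) and \<open>0\<close> for cumulant sequences.
\<close>

section \<open>Sequences determined by a triangular system\<close>

lemma triangular_ex1:
  fixes G :: "(nat \<Rightarrow> real) \<Rightarrow> nat \<Rightarrow> real" and c m :: "nat \<Rightarrow> real"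
  assumes c: "\<And>k. k \<ge> 1 \<Longrightarrow> c k \<noteq> 0"
    and G: "\<And>x y k. k \<ge> 1 \<Longrightarrow> (\<And>j. j < k \<Longrightarrow> x j = y j) \<Longrightarrow> G x k - G y k = c k * (x k - y k)"
  shows "\<exists>!x. x 0 = 0 \<and> (\<forall>k\<ge>1. G x k = m k)"
proof (rule ex_ex1I)
  define y where
    "y = rec_nat (\<lambda>_. 0) (\<lambda>n x. x(Suc n := x (Suc n) + (m (Suc n) - G x (Suc n)) / c (Suc n)))"
  have y0: "y 0 = (\<lambda>_. 0)"
    and yS: "y (Suc n) = (y n)(Suc n := y n (Suc n) + (m (Suc n) - G (y n) (Suc n)) / c (Suc n))" for n
    by (simp_all add: y_def)
  have stable: "y (j + d) j = y j j" for j d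
    by (induction d) (simp_all add: yS)
  define x where "x k = y k k" for k
  have x_eq: "x j = y n j" if "j \<le> n" for j n
    using stable[of j "n - j"] that by (simp add: x_def)
  show "\<exists>x. x 0 = 0 \<and> (\<forall>k\<ge>1. G x k = m k)"
  proof (intro exI conjI allI impI)
    show "x 0 = 0" by (simp add: x_def y0)
    fix k :: nat assume k: "k \<ge> 1"
    then obtain n where n: "k = Suc n" by (cases k) auto
    have "G x k - G (y n) k = c k * (x k - y n k)"
      using k n by (intro G) (auto intro!: x_eq)
    also have "x k - y n k = (m k - G (y n) k) / c k"
      by (simp add: x_def n yS)
    finally show "G x k = m k" using c[OF k] by simp
  qed
next
  fix x y assume x: "x 0 = 0 \<and> (\<forall>k\<ge>1. G x k = m k)" and y: "y 0 = 0 \<and> (\<forall>k\<ge>1. G y k = m k)"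
  have "x k = y k" for k
  proof (induction k rule: less_induct)
    case (less k)
    show ?case
    proof (cases "k = 0")
      case False
      then have k: "k \<ge> 1" by simp
      from G[of k x y, OF k less] x y k have "c k * (x k - y k) = 0" by simp
      then show ?thesis using c[OF k] by simp
    qed (use x y in simp)
  qed
  then show "x = y" by (rule ext)
qed

lemma ex1_even_seq:
  fixes R :: "(nat \<Rightarrow> real) \<Rightarrow> bool"
  assumes "\<exists>!x. x 0 = 0 \<and> R (\<lambda>l. if even l then x (l div 2) else 0)"
  shows "\<exists>!\<kappa>. \<kappa> 0 = 0 \<and> (\<forall>l. odd l \<longrightarrow> \<kappa> l = 0) \<and> R \<kappa>"
proof -
  have split: "(\<lambda>l. if even l then (\<lambda>k. \<kappa> (2 * k)) (l div 2) else 0) = \<kappa>"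
    if "\<forall>l. odd l \<longrightarrow> \<kappa> l = 0" for \<kappa> :: "nat \<Rightarrow> real"
    using that by (auto simp: fun_eq_iff)
  from assms obtain x where x: "x 0 = 0" "R (\<lambda>l. if even l then x (l div 2) else 0)" by blast
  show ?thesis
  proof (rule ex1I[of _ "\<lambda>l. if even l then x (l div 2) else 0"])
    show "(if even 0 then x (0 div 2) else 0) = 0 \<and>
      (\<forall>l. odd l \<longrightarrow> (if even l then x (l div 2) else 0) = 0) \<and>
      R (\<lambda>l. if even l then x (l div 2) else 0)"
      using x by simp
    fix \<kappa> assume \<kappa>: "\<kappa> 0 = 0 \<and> (\<forall>l. odd l \<longrightarrow> \<kappa> l = 0) \<and> R \<kappa>"
    note \<kappa>_eq = split[OF conjunct1[OF conjunct2[OF \<kappa>]]]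
    have "(\<lambda>k. \<kappa> (2 * k)) = x"
    proof (rule ex1E[OF assms])
      fix z assume z: "\<forall>w. w 0 = 0 \<and> R (\<lambda>l. if even l then w (l div 2) else 0) \<longrightarrow> w = z"
      have "x = z" using z x by blast
      moreover have "(\<lambda>k. \<kappa> (2 * k)) = z"
        using \<kappa> by (intro z[rule_format] conjI) (simp, subst \<kappa>_eq, simp)
      ultimately show ?thesis by simp
    qed
    then have "x = (\<lambda>k. \<kappa> (2 * k))" by (rule sym)
    then show "\<kappa> = (\<lambda>l. if even l then x (l div 2) else 0)"
      by (simp only: \<kappa>_eq)
  qed
qed

section \<open>The \<open>q\<close>-\<open>\<gamma>\<close> cumulants and convolution\<close>

definition d_op :: "real fps \<Rightarrow> real fps" where
  "d_op f = Abs_fps (\<lambda>n. fps_nth f (n + 1))"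

definition d'_op :: "real fps \<Rightarrow> real fps" where
  "d'_op f = Abs_fps (\<lambda>n. if odd (n + 1) then 2 * fps_nth f (n + 1) else 0)"

definition qg_op :: "real \<Rightarrow> real \<Rightarrow> real fps \<Rightarrow> real fps \<Rightarrow> real fps" where
  "qg_op q \<gamma> g f = fps_deriv f + fps_const (2 * \<gamma>) * d_op f
     + fps_const ((q - 1) * \<gamma> - 1 / 2) * d'_op f + g * f"

definition cumulant_fps :: "(nat \<Rightarrow> real) \<Rightarrow> real fps" where
  "cumulant_fps \<kappa> = Abs_fps (\<lambda>n. \<kappa> (n + 1))"

text \<open>\<open>qg_moment q \<gamma> \<kappa> k\<close> is the moment of order \<open>2 * k\<close>, for \<open>k \<ge> 1\<close>.\<close>

definition qg_moment :: "real \<Rightarrow> real \<Rightarrow> (nat \<Rightarrow> real) \<Rightarrow> nat \<Rightarrow> real" where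
  "qg_moment q \<gamma> \<kappa> k =
     fps_nth ((qg_op q \<gamma> (cumulant_fps \<kappa>) ^^ (2 * k - 1)) (cumulant_fps \<kappa>)) 0"

definition qg_cumulants :: "real \<Rightarrow> real \<Rightarrow> (nat \<Rightarrow> real) \<Rightarrow> nat \<Rightarrow> real" where
  "qg_cumulants q \<gamma> m = (THE \<kappa>. \<kappa> 0 = 0 \<and> (\<forall>l. odd l \<longrightarrow> \<kappa> l = 0) \<and>
     (\<forall>k\<ge>1. qg_moment q \<gamma> \<kappa> k = m (2 * k)))"

definition qg_conv :: "real \<Rightarrow> real \<Rightarrow> (nat \<Rightarrow> real) \<Rightarrow> (nat \<Rightarrow> real) \<Rightarrow> nat \<Rightarrow> real" where
  "qg_conv q \<gamma> ma mb k =
     (if k = 0 then 1 else if odd k then 0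
      else qg_moment q \<gamma> (\<lambda>l. qg_cumulants q \<gamma> ma l + qg_cumulants q \<gamma> mb l) (k div 2))"

lemma qg_op_nth:
  "fps_nth (qg_op q \<gamma> g f) n =
     (if even n then real n + 2 * q * \<gamma> else real n + 1 + 2 * \<gamma>) * fps_nth f (n + 1)
     + (\<Sum>j\<le>n. fps_nth g j * fps_nth f (n - j))"
proof -
  have "fps_nth (g * f) n = (\<Sum>j\<le>n. fps_nth g j * fps_nth f (n - j))"
    by (simp add: fps_mult_nth atLeast0AtMost)
  then show ?thesis
    by (simp add: qg_op_def d_op_def d'_op_def algebra_simps)
qed

lemma qg_iterate_triangular:
  fixes f g :: "real fps" and q \<gamma> :: real and N :: nat
  defines "a \<equiv> (\<lambda>n. if even n then real n + 2 * q * \<gamma> else real n + 1 + 2 * \<gamma>)"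
  assumes fg: "\<And>i. i < N \<Longrightarrow> fps_nth f i = fps_nth g i"
  shows "(i + n < N \<longrightarrow> fps_nth ((qg_op q \<gamma> f ^^ n) f) i = fps_nth ((qg_op q \<gamma> g ^^ n) g) i) \<and>
    (i + n = N \<longrightarrow> fps_nth ((qg_op q \<gamma> f ^^ n) f) i - fps_nth ((qg_op q \<gamma> g ^^ n) g) i
       = (\<Prod>t=i..<N. a t) * (fps_nth f N - fps_nth g N))"
proof (induction n arbitrary: i)
  case 0
  then show ?case using fg by auto
next
  case (Suc n)
  let ?F = "(qg_op q \<gamma> f ^^ n) f" and ?G = "(qg_op q \<gamma> g ^^ n) g"
  have lower: "fps_nth f j * fps_nth ?F (i - j) = fps_nth g j * fps_nth ?G (i - j)"
    if "j \<le> i" "i + Suc n \<le> N" for j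
    using Suc.IH[of "i - j"] fg[of j] that by auto
  have diff: "fps_nth ((qg_op q \<gamma> f ^^ Suc n) f) i - fps_nth ((qg_op q \<gamma> g ^^ Suc n) g) i
      = a i * (fps_nth ?F (i + 1) - fps_nth ?G (i + 1))" if "i + Suc n \<le> N"
  proof -
    have "(\<Sum>j\<le>i. fps_nth f j * fps_nth ?F (i - j)) = (\<Sum>j\<le>i. fps_nth g j * fps_nth ?G (i - j))"
      using lower that by (intro sum.cong) auto
    then show ?thesis by (simp add: qg_op_nth a_def algebra_simps)
  qed
  show ?case
  proof (intro conjI impI)
    assume "i + Suc n < N"
    then show "fps_nth ((qg_op q \<gamma> f ^^ Suc n) f) i = fps_nth ((qg_op q \<gamma> g ^^ Suc n) g) i"
      using diff Suc.IH[of "i + 1"] by auto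
  next
    assume *: "i + Suc n = N"
    then have "(\<Prod>t=i..<N. a t) = a i * (\<Prod>t=i+1..<N. a t)"
      by (simp add: prod.atLeast_Suc_lessThan)
    then show "fps_nth ((qg_op q \<gamma> f ^^ Suc n) f) i - fps_nth ((qg_op q \<gamma> g ^^ Suc n) g) i
       = (\<Prod>t=i..<N. a t) * (fps_nth f N - fps_nth g N)"
      using diff Suc.IH[of "i + 1"] * by auto
  qed
qed

text \<open>The map from cumulants to moments is invertible, so the description above is proper.\<close>

lemma qg_cumulants_ex1:
  fixes m :: "nat \<Rightarrow> real"
  assumes "q \<ge> 1" "\<gamma> > 0"
  shows "\<exists>!\<kappa>. \<kappa> 0 = 0 \<and> (\<forall>l. odd l \<longrightarrow> \<kappa> l = 0) \<and> (\<forall>k\<ge>1. qg_moment q \<gamma> \<kappa> k = m (2 * k))"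
proof (rule ex1_even_seq, rule triangular_ex1)
  define a where "a n = (if even n then real n + 2 * q * \<gamma> else real n + 1 + 2 * \<gamma>)" for n
  have "a n > 0" for n
  proof -
    have "2 * q * \<gamma> > 0" "2 * \<gamma> > 0" using assms by auto
    moreover have "real n \<ge> 0" by simp
    ultimately have "real n + 2 * q * \<gamma> > 0" "real n + 1 + 2 * \<gamma> > 0" by linarith+
    then show ?thesis by (cases "even n") (simp_all only: a_def if_True if_False)
  qed
  then show "(\<Prod>t=0..<2 * k - 1. a t) \<noteq> 0" for k
    by (metis less_irrefl prod_pos)
  fix x y :: "nat \<Rightarrow> real" and k :: nat assume k: "k \<ge> 1" and xy: "\<And>j. j < k \<Longrightarrow> x j = y j"
  let ?x = "\<lambda>l. if even l then x (l div 2) else 0" and ?y = "\<lambda>l. if even l then y (l div 2) else 0"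
  have "fps_nth (cumulant_fps ?x) i = fps_nth (cumulant_fps ?y) i" if "i < 2 * k - 1" for i
    using that by (auto simp: cumulant_fps_def elim!: oddE intro!: xy)
  from qg_iterate_triangular[of "2 * k - 1", OF this, of 0 "2 * k - 1" q \<gamma>]
  show "qg_moment q \<gamma> ?x k - qg_moment q \<gamma> ?y k = (\<Prod>t=0..<2 * k - 1. a t) * (x k - y k)"
    using k by (simp add: qg_moment_def a_def cumulant_fps_def)
qed

section \<open>Moment sequences and the usual convolution and cumulants\<close>

definition has_moments :: "real measure \<Rightarrow> (nat \<Rightarrow> real) \<Rightarrow> bool" where
  "has_moments \<mu> m \<longleftrightarrow> real_distribution \<mu> \<and>
     (\<forall>k. integrable \<mu> (\<lambda>x. x ^ k) \<and> (\<integral>x. x ^ k \<partial>\<mu>) = m k)"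

definition moment_seq :: "(nat \<Rightarrow> real) \<Rightarrow> bool" where
  "moment_seq m \<longleftrightarrow> (\<exists>\<mu>. has_moments \<mu> m)"

text \<open>
  \<open>corresponding_dist \<mu> m\<close>: \<open>\<mu>\<close> is the law of a nonnegative random variable whose moment of
  order \<open>k\<close> is \<open>m (2 * k)\<close>.  Such a law need not be unique.
\<close>

definition corresponding_dist :: "real measure \<Rightarrow> (nat \<Rightarrow> real) \<Rightarrow> bool" where
  "corresponding_dist \<mu> m \<longleftrightarrow> has_moments \<mu> (\<lambda>k. m (2 * k)) \<and> (AE x in \<mu>. x \<ge> 0)"

lemma corresponding_dist_exists:
  assumes "moment_seq m"
  shows "\<exists>\<mu>. corresponding_dist \<mu> m"
proof -
  from assms obtain \<mu> where \<mu>: "real_distribution \<mu>"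
    "\<And>k. integrable \<mu> (\<lambda>x. x ^ k)" "\<And>k. (\<integral>x. x ^ k \<partial>\<mu>) = m k"
    by (auto simp: moment_seq_def has_moments_def)
  interpret real_distribution \<mu> by fact
  have [measurable]: "(\<lambda>x. x\<^sup>2) \<in> borel_measurable \<mu>" by measurable
  have "corresponding_dist (distr \<mu> borel (\<lambda>x. x\<^sup>2)) m"
    using \<mu>(2,3)
    by (auto simp: corresponding_dist_def has_moments_def integrable_distr_eq integral_distr
        AE_distr_iff power_mult[symmetric])
  then show ?thesis ..
qed

text \<open>The \<open>l\<close>-th usual cumulant of the variable corresponding to \<open>m\<close>.\<close>

definition usual_cumulants :: "(nat \<Rightarrow> real) \<Rightarrow> nat \<Rightarrow> real" where
  "usual_cumulants m = (THE \<kappa>. \<kappa> 0 = 0 \<and>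
     (\<forall>k\<ge>1. m (2 * k) = (\<Sum>P | partition_on {1..k} P. \<Prod>B\<in>P. \<kappa> (card B))))"

lemma partition_block_card_less:
  assumes "partition_on A P" "finite A" "P \<noteq> {A}" "B \<in> P"
  shows "card B < card A"
proof -
  have "B \<noteq> A"
  proof
    assume "B = A"
    have "C = A" if "C \<in> P" for C
    proof (rule ccontr)
      assume "C \<noteq> A"
      with assms(1,4) that \<open>B = A\<close> have "disjnt C A"
        by (auto simp: partition_on_def pairwise_def)
      moreover have "C \<subseteq> A" "C \<noteq> {}" using assms(1) that by (auto simp: partition_on_def)
      ultimately show False by (auto simp: disjnt_def)
    qed
    with assms(3,4) show False by auto
  qed
  moreover have "B \<subseteq> A" using assms by (auto simp: partition_on_def)
  ultimately show ?thesis using assms(2) by (simp add: psubset_card_mono psubsetI)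
qed

lemma partition_sum_diff:
  fixes x y :: "nat \<Rightarrow> real" and w :: "nat set set \<Rightarrow> real"
  assumes "finite A" "A \<noteq> {}" "Q {A}" and xy: "\<And>j. j < card A \<Longrightarrow> x j = y j"
  shows "(\<Sum>P | partition_on A P \<and> Q P. w P * (\<Prod>B\<in>P. x (card B)))
       - (\<Sum>P | partition_on A P \<and> Q P. w P * (\<Prod>B\<in>P. y (card B)))
       = w {A} * (x (card A) - y (card A))"
proof -
  let ?S = "{P. partition_on A P \<and> Q P}"
  have fin: "finite ?S"
    using finitely_many_partition_on[OF \<open>finite A\<close>] by (rule rev_finite_subset) auto
  have "{A} \<in> ?S" using assms by (auto intro: partition_on_space)
  moreover have "(\<Sum>P\<in>?S - {{A}}. w P * (\<Prod>B\<in>P. x (card B)))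
      = (\<Sum>P\<in>?S - {{A}}. w P * (\<Prod>B\<in>P. y (card B)))"
    by (intro sum.cong refl arg_cong2[where f = "(*)"] prod.cong xy)
       (use assms(1) in \<open>auto intro: partition_block_card_less\<close>)
  ultimately show ?thesis
    by (simp add: sum.remove[OF fin] algebra_simps)
qed

lemma usual_cumulants_ex1:
  fixes m :: "nat \<Rightarrow> real"
  shows "\<exists>!\<kappa>. \<kappa> 0 = 0 \<and>
     (\<forall>k\<ge>1. m (2 * k) = (\<Sum>P | partition_on {1..k} P. \<Prod>B\<in>P. \<kappa> (card B)))"
proof -
  have "\<exists>!\<kappa>. \<kappa> 0 = 0 \<and>
     (\<forall>k\<ge>1. (\<Sum>P | partition_on {1..k} P. \<Prod>B\<in>P. \<kappa> (card B)) = m (2 * k))"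
  proof (rule triangular_ex1[where c = "\<lambda>_. 1"])
    fix x y :: "nat \<Rightarrow> real" and k :: nat assume "k \<ge> 1" "\<And>j. j < k \<Longrightarrow> x j = y j"
    then show "(\<Sum>P | partition_on {1..k} P. \<Prod>B\<in>P. x (card B))
       - (\<Sum>P | partition_on {1..k} P. \<Prod>B\<in>P. y (card B)) = 1 * (x k - y k)"
      using partition_sum_diff[of "{1..k}" "\<lambda>_. True" x y "\<lambda>_. 1"] by simp
  qed simp
  then show ?thesis by (simp add: eq_commute[of "m _"])
qed

section \<open>Rectangular free cumulants and convolution\<close>

definition noncrossing :: "nat set set \<Rightarrow> bool" where
  "noncrossing P \<longleftrightarrow> \<not> (\<exists>B\<in>P. \<exists>C\<in>P. \<exists>i\<in>B. \<exists>j\<in>C. \<exists>k\<in>B. \<exists>l\<in>C. B \<noteq> C \<and> i < j \<and> j < k \<and> k < l)"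

definition NC_even :: "nat \<Rightarrow> nat set set set" where
  "NC_even n = {P. partition_on {1..n} P \<and> noncrossing P \<and> (\<forall>B\<in>P. even (card B))}"

definition even_min_blocks :: "nat set set \<Rightarrow> nat" where
  "even_min_blocks P = card {B \<in> P. even (Min B)}"

definition rect_free_moment :: "real \<Rightarrow> (nat \<Rightarrow> real) \<Rightarrow> nat \<Rightarrow> real" where
  "rect_free_moment q c k =
     (\<Sum>P\<in>NC_even (2 * k). (1 / q) ^ even_min_blocks P * (\<Prod>B\<in>P. c (card B)))"

definition rect_free_cumulants :: "real \<Rightarrow> (nat \<Rightarrow> real) \<Rightarrow> nat \<Rightarrow> real" where
  "rect_free_cumulants q m = (THE c. c 0 = 0 \<and> (\<forall>l. odd l \<longrightarrow> c l = 0) \<and>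
     (\<forall>k\<ge>1. rect_free_moment q c k = m (2 * k)))"

definition rect_free_conv :: "real \<Rightarrow> (nat \<Rightarrow> real) \<Rightarrow> (nat \<Rightarrow> real) \<Rightarrow> nat \<Rightarrow> real" where
  "rect_free_conv q ma mb k =
     (if k = 0 then 1 else if odd k then 0
      else rect_free_moment q (\<lambda>l. rect_free_cumulants q ma l + rect_free_cumulants q mb l) (k div 2))"

lemma rect_free_cumulants_ex1:
  fixes m :: "nat \<Rightarrow> real"
  shows "\<exists>!c. c 0 = 0 \<and> (\<forall>l. odd l \<longrightarrow> c l = 0) \<and> (\<forall>k\<ge>1. rect_free_moment q c k = m (2 * k))"
proof (rule ex1_even_seq, rule triangular_ex1[where c = "\<lambda>_. 1"])
  fix x y :: "nat \<Rightarrow> real" and k :: nat assume k: "k \<ge> 1" and xy: "\<And>j. j < k \<Longrightarrow> x j = y j"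
  let ?x = "\<lambda>l. if even l then x (l div 2) else 0" and ?y = "\<lambda>l. if even l then y (l div 2) else 0"
  have "Min {1..2 * k} = 1"
    using k by (intro Min_eqI) auto
  then have "{B \<in> {{1..2 * k}}. even (Min B)} = {}"
    by auto
  then have "even_min_blocks {{1..2 * k}} = 0"
    by (simp only: even_min_blocks_def card.empty)
  moreover have "?x j = ?y j" if "j < card {1..2 * k}" for j
    using that by (auto intro!: xy)
  ultimately show "rect_free_moment q ?x k - rect_free_moment q ?y k = 1 * (x k - y k)"
    unfolding rect_free_moment_def NC_even_def
    using k partition_sum_diff[of "{1..2 * k}" "\<lambda>P. noncrossing P \<and> (\<forall>B\<in>P. even (card B))" ?x ?y
        "\<lambda>P. (1 / q) ^ even_min_blocks P"]
    by (simp add: noncrossing_def)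
qed simp

section \<open>The first limit regime\<close>

text \<open>The filter on pairs \<open>(q, \<gamma>)\<close> with \<open>q \<ge> 1\<close> and \<open>\<gamma> > 0\<close> for \<open>\<gamma> \<rightarrow> 0\<close> and \<open>q * \<gamma> \<rightarrow> \<infinity>\<close>.\<close>

definition classical_regime :: "(real \<times> real) filter" where
  "classical_regime = inf (principal {(q, \<gamma>). q \<ge> 1 \<and> \<gamma> > 0})
     (inf (filtercomap (\<lambda>(q, \<gamma>). \<gamma>) (nhds 0)) (filtercomap (\<lambda>(q, \<gamma>). q * \<gamma>) at_top))"

lemma eventually_classical_regime:
  "eventually P classical_regime \<longleftrightarrow>
     (\<exists>\<epsilon>>0. \<exists>C. \<forall>q \<gamma>. q \<ge> 1 \<and> 0 < \<gamma> \<and> \<gamma> < \<epsilon> \<and> q * \<gamma> > C \<longrightarrow> P (q, \<gamma>))"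
proof
  assume "eventually P classical_regime"
  then obtain A B where A: "eventually A (nhds 0)" and B: "eventually B at_top"
    and P: "\<And>q \<gamma>. q \<ge> 1 \<Longrightarrow> \<gamma> > 0 \<Longrightarrow> A \<gamma> \<Longrightarrow> B (q * \<gamma>) \<Longrightarrow> P (q, \<gamma>)"
    unfolding classical_regime_def eventually_inf eventually_principal eventually_filtercomap
    by (force simp: split_beta)
  from A obtain \<epsilon> where "\<epsilon> > 0" "\<And>x. dist x 0 < \<epsilon> \<Longrightarrow> A x" by (auto simp: eventually_nhds_metric)
  moreover from B obtain C where "\<And>x. x > C \<Longrightarrow> B x" by (auto simp: eventually_at_top_dense)
  ultimately show "\<exists>\<epsilon>>0. \<exists>C. \<forall>q \<gamma>. q \<ge> 1 \<and> 0 < \<gamma> \<and> \<gamma> < \<epsilon> \<and> q * \<gamma> > C \<longrightarrow> P (q, \<gamma>)"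
    using P by (intro exI[of _ \<epsilon>] conjI exI[of _ C]) (auto simp: dist_norm)
next
  assume "\<exists>\<epsilon>>0. \<exists>C. \<forall>q \<gamma>. q \<ge> 1 \<and> 0 < \<gamma> \<and> \<gamma> < \<epsilon> \<and> q * \<gamma> > C \<longrightarrow> P (q, \<gamma>)"
  then obtain \<epsilon> C where \<epsilon>: "\<epsilon> > 0"
    and P: "\<And>q \<gamma>. q \<ge> 1 \<Longrightarrow> 0 < \<gamma> \<Longrightarrow> \<gamma> < \<epsilon> \<Longrightarrow> q * \<gamma> > C \<Longrightarrow> P (q, \<gamma>)" by blast
  have "eventually (\<lambda>(q, \<gamma>). q \<ge> 1 \<and> \<gamma> > 0) classical_regime"
    unfolding classical_regime_def by (rule filter_leD[OF inf_le1]) (simp add: eventually_principal)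
  moreover have "eventually (\<lambda>p. (\<lambda>(q, \<gamma>). \<gamma>) p < \<epsilon>) classical_regime"
    unfolding classical_regime_def
    by (rule filter_leD[OF le_infI2[OF inf_le1]], rule eventually_filtercomapI)
       (use \<epsilon> in \<open>auto intro: eventually_nhds_in_open[of "{..<\<epsilon>}", simplified]\<close>)
  moreover have "eventually (\<lambda>p. (\<lambda>(q, \<gamma>). q * \<gamma>) p > C) classical_regime"
    unfolding classical_regime_def
    by (rule filter_leD[OF le_infI2[OF inf_le2]], rule eventually_filtercomapI)
       (rule eventually_gt_at_top)
  ultimately show "eventually P classical_regime"
    by eventually_elim (auto intro: P)
qed

end

theory Submission
  imports Defs
begin

text \<open>
  The moment \<open>m\<^sub>2\<^sub>k\<close> is the constant term of the \<open>2k\<close>-th iterate of the operator applied to \<open>1\<close>, that is, a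
  weighted sum over Lukasiewicz paths of length \<open>2k\<close>: the descent from height \<open>i + 1\<close> to \<open>i\<close> has weight
  \<open>i + 2q\<gamma>\<close> or \<open>i + 1 + 2\<gamma>\<close> according to the parity of \<open>i\<close>, an ascent by \<open>j\<close> has weight \<open>\<kappa>\<^sub>j\<^sub>+\<^sub>1\<close>.
  Rescaling by a product of \<open>\<alpha>\<close> (even heights) and \<open>\<beta>\<close> (odd heights) moves the divergent factors into
  the cumulants, and all weights converge.

  With \<open>\<alpha> = 2q\<gamma>\<close> and \<open>\<beta> = 2\<gamma>\<close> the limiting descents have weight \<open>1\<close> and ascents from odd heights carry
  a factor \<open>1/q\<close>; such paths encode non-crossing partitions.  With \<open>\<alpha> = 2q\<gamma>\<close> and \<open>\<beta> = 1\<close> ascents from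
  odd heights vanish in the limit, and two consecutive steps amount to the operator \<open>\<partial> + K'\<close> on \<open>\<real>[[z]]\<close>, where
  \<open>K\<close> is the usual cumulant generating function; since \<open>(\<partial> + K')\<^sup>k 1 = e\<^sup>-\<^sup>K \<partial>\<^sup>k e\<^sup>K\<close>, the constant
  terms are the usual moments.

  Both systems are triangular in the cumulants with leading coefficients that do not degenerate, so the convergence
  of moments can be inverted.
\<close>

section \<open>Non-crossing partitions\<close>

text \<open>Half-open intervals keep both pieces of a cut in the same family, the empty interval
  included.\<close>

definition nc_partitions :: "nat \<Rightarrow> nat \<Rightarrow> nat set set set" where
  "nc_partitions a b = {P. partition_on {a..<b} P \<and> noncrossing P}"

text \<open>Weighting a block through its minimum lets one \<open>u\<close> produce the factor
  \<open>1 / q\<close> for each block with even minimum.\<close>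

definition nc_sum :: "(nat \<Rightarrow> real) \<Rightarrow> (nat \<Rightarrow> real) \<Rightarrow> nat \<Rightarrow> nat \<Rightarrow> real" where
  "nc_sum u c a b = (\<Sum>P\<in>nc_partitions a b. \<Prod>B\<in>P. u (Min B) * c (card B))"

text \<open>The block of \<open>a\<close> is counted as if it had \<open>s\<close> further elements; so that a block can be cut at its second element.\<close>

definition nc_shift_sum :: "(nat \<Rightarrow> real) \<Rightarrow> (nat \<Rightarrow> real) \<Rightarrow> nat \<Rightarrow> nat \<Rightarrow> nat \<Rightarrow> real" where
  "nc_shift_sum u c s a b =
     (\<Sum>P\<in>nc_partitions a b. \<Prod>B\<in>P. if a \<in> B then c (card B + s) else u (Min B) * c (card B))"

section \<open>Cutting a non-crossing partition at the second element of its first block\<close>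

definition nc_join :: "nat \<Rightarrow> nat \<Rightarrow> nat set set \<times> nat set set \<Rightarrow> nat set set" where
  "nc_join a i = (\<lambda>(P, Q). P \<union> (\<lambda>B. if i \<in> B then insert a B else B) ` Q)"

lemma noncrossingD:
  assumes "noncrossing P" "B \<in> P" "C \<in> P" "i \<in> B" "j \<in> C" "k \<in> B" "l \<in> C" "i < j" "j < k" "k < l"
  shows "B = C"
  using assms unfolding noncrossing_def by blast

lemma noncrossingI:
  assumes "\<And>B C i j k l. B \<in> P \<Longrightarrow> C \<in> P \<Longrightarrow> B \<noteq> C \<Longrightarrow> i \<in> B \<Longrightarrow> j \<in> C \<Longrightarrow> k \<in> B \<Longrightarrow> l \<in> C \<Longrightarrow>
    i < j \<Longrightarrow> j < k \<Longrightarrow> k < l \<Longrightarrow> False"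
  shows "noncrossing P"
  unfolding noncrossing_def using assms by metis

lemma partition_on_block_eq:
  assumes "partition_on A P" "B \<in> P" "C \<in> P" "x \<in> B" "x \<in> C"
  shows "B = C"
  using assms by (auto simp: partition_on_def disjoint_def)

lemma partition_on_block_ex:
  assumes "partition_on A P" "x \<in> A"
  shows "\<exists>B\<in>P. x \<in> B"
  using assms by (auto simp: partition_on_def)

lemma partition_on_block_subset:
  assumes "partition_on A P" "B \<in> P"
  shows "B \<subseteq> A" "B \<noteq> {}"
  using assms by (auto simp: partition_on_def)

lemma finite_nc_partitions: "finite (nc_partitions a b)"
  using finitely_many_partition_on[of "{a..<b}"]
  by (rule rev_finite_subset) (auto simp: nc_partitions_def)

lemma nc_partitionsD:
  assumes "P \<in> nc_partitions a b"
  shows "partition_on {a..<b} P" "noncrossing P" "finite P"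
  using assms finite_elements[of "{a..<b}" P] by (auto simp: nc_partitions_def)

lemma nc_partitions_empty [simp]: "nc_partitions a a = {{}}"
  by (auto simp: nc_partitions_def noncrossing_def partition_on_empty)

text \<open>For \<open>a < i\<close> this makes \<open>i\<close> the second smallest element of the
  block of \<open>a\<close>: the inclusion leaves nothing strictly between them.\<close>

definition nc_second :: "nat \<Rightarrow> nat \<Rightarrow> nat \<Rightarrow> nat set set set" where
  "nc_second a i b = {P \<in> nc_partitions a b. \<exists>B\<in>P. a \<in> B \<and> i \<in> B \<and> B \<subseteq> insert a {i..}}"

text \<open>The blocks of \<open>P\<close> stay inside the gap between \<open>a\<close> and
  \<open>i\<close>, and adding \<open>a\<close> to the block of \<open>i\<close>, the least point of
  the right piece, creates no crossing.\<close>

lemma nc_join_mem: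
  assumes "a < i" "i < b" "P \<in> nc_partitions (Suc a) i" "Q \<in> nc_partitions i b"
  shows "nc_join a i (P, Q) \<in> nc_second a i b"
proof -
  note P = nc_partitionsD[OF assms(3)] and Q = nc_partitionsD[OF assms(4)]
  let ?f = "\<lambda>B. if i \<in> B then insert a B else B"
  let ?R = "P \<union> ?f ` Q"
  have Psub: "B \<subseteq> {Suc a..<i}" "B \<noteq> {}" if "B \<in> P" for B
    using partition_on_block_subset[OF P(1) that] .
  have Qsub: "B \<subseteq> {i..<b}" "B \<noteq> {}" if "B \<in> Q" for B
    using partition_on_block_subset[OF Q(1) that] .
  have "partition_on {a..<b} ?R"
  proof (rule partition_onI)
    show "\<Union>?R = {a..<b}"
    proof -
      obtain C where C: "C \<in> Q" "i \<in> C" using partition_on_block_ex[OF Q(1), of i] assms by auto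
      have "\<Union>(?f ` Q) = insert a (\<Union>Q)" using C by auto
      moreover have "\<Union>Q = {i..<b}" "\<Union>P = {Suc a..<i}" using P Q by (auto simp: partition_on_def)
      ultimately have "\<Union>?R = {Suc a..<i} \<union> insert a {i..<b}" by (simp only: Union_Un_distrib)
      then show ?thesis using assms by auto
    qed
    have "{} \<notin> P" "{} \<notin> Q" using P Q by (auto simp: partition_on_def)
    then show "{} \<notin> ?R" by (auto split: if_splits)
    fix B C assume BC: "B \<in> ?R" "C \<in> ?R" "B \<noteq> C"
    have PQ: "disjnt B (?f C)" if "B \<in> P" "C \<in> Q" for B C
      using Psub(1)[OF that(1)] Qsub(1)[OF that(2)] by (fastforce simp: disjnt_def split: if_splits)
    have QQ: "disjnt (?f B) (?f C)" if "B \<in> Q" "C \<in> Q" "B \<noteq> C" for B C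
      using Qsub(1)[OF that(1)] Qsub(1)[OF that(2)] partition_on_block_eq[OF Q(1) that(1,2)] that(3) assms(1)
      by (fastforce simp: disjnt_def split: if_splits)
    have PP: "disjnt B C" if "B \<in> P" "C \<in> P" "B \<noteq> C" for B C
      using partition_on_block_eq[OF P(1) that(1,2)] that(3) by (auto simp: disjnt_def)
    show "disjnt B C" using BC PQ QQ PP
      by (smt (verit) Un_iff disjnt_sym imageE)
  qed
  moreover have "noncrossing ?R"
  proof (rule noncrossingI)
    fix B C x y z w
    assume BC: "B \<in> ?R" "C \<in> ?R" and ne: "B \<noteq> C" and xs: "x \<in> B" "y \<in> C" "z \<in> B" "w \<in> C" "x < y" "y < z" "z < w"
    consider (1) "B \<in> P" "C \<in> P" | (2) "B \<in> P" "C \<in> ?f ` Q" | (3) "B \<in> ?f ` Q" "C \<in> P" | (4) "B \<in> ?f ` Q" "C \<in> ?f ` Q"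
      using BC by blast
    then show False
    proof cases
      case 1
      then show ?thesis using noncrossingD[OF P(2) 1, of x y z w] xs ne by blast
    next
      case 2
      then obtain C' where C': "C' \<in> Q" "C = ?f C'" by blast
      have "x \<in> {Suc a..<i}" "z \<in> {Suc a..<i}" using Psub(1)[OF 2(1)] xs by auto
      moreover have "y = a \<or> y \<ge> i" using C' Qsub(1)[OF C'(1)] xs by (auto split: if_splits)
      ultimately show ?thesis using xs by auto
    next
      case 3
      then obtain B' where C': "B' \<in> Q" "B = ?f B'" by blast
      have "y \<in> {Suc a..<i}" "w \<in> {Suc a..<i}" using Psub(1)[OF 3(2)] xs by auto
      moreover have "z = a \<or> z \<ge> i" using C' Qsub(1)[OF C'(1)] xs by (auto split: if_splits)
      ultimately show ?thesis using xs by auto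
    next
      case 4
      then obtain B' C' where B': "B' \<in> Q" "B = ?f B'" and C': "C' \<in> Q" "C = ?f C'" by blast
      have ne': "B' \<noteq> C'" using ne B' C' by auto
      have ge: "x \<ge> a" using B' Qsub(1)[OF B'(1)] xs assms(1) by (fastforce split: if_splits)
      have yz: "y \<in> C'" "w \<in> C'" "z \<in> B'" using xs ge B' C' by (auto split: if_splits)
      show ?thesis
      proof (cases "x \<in> B'")
        case True
        then show ?thesis using noncrossingD[OF Q(2) B'(1) C'(1), of x y z w] xs yz ne' by blast
      next
        case False
        \<comment> \<open>Here \<open>x = a\<close>. As \<open>i\<close> lies in the same block
          \<open>B'\<close> and still precedes \<open>y\<close>, it replaces \<open>x\<close> in a
          crossing of \<open>Q\<close>.\<close>
        then have i: "i \<in> B'" using B' xs by (auto split: if_splits)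
        have "y \<ge> i" using Qsub(1)[OF C'(1)] yz by auto
        moreover have "y \<noteq> i" using i yz ne' partition_on_block_eq[OF Q(1) B'(1) C'(1)] by blast
        ultimately show ?thesis using noncrossingD[OF Q(2) B'(1) C'(1), of i y z w] i xs yz ne' by auto
      qed
    qed
  qed
  moreover have "\<exists>B\<in>?R. a \<in> B \<and> i \<in> B \<and> B \<subseteq> insert a {i..}"
  proof -
    obtain C where C: "C \<in> Q" "i \<in> C" using partition_on_block_ex[OF Q(1), of i] assms by auto
    then have "insert a C \<in> ?R" by (auto intro!: image_eqI[of _ _ C])
    then show ?thesis using C Qsub(1)[OF C(1)] by (intro bexI[of _ "insert a C"]) auto
  qed
  ultimately show ?thesis by (simp add: nc_join_def nc_partitions_def nc_second_def)
qed

definition nc_cut :: "nat \<Rightarrow> nat \<Rightarrow> nat set set \<Rightarrow> nat set set \<times> nat set set" where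
  "nc_cut a i R = ({B \<in> R. B \<subseteq> {Suc a..<i}}, (\<lambda>B. B - {a}) ` {B \<in> R. \<not> B \<subseteq> {Suc a..<i}})"

text \<open>A block built from \<open>Q\<close> has a point at or beyond \<open>i\<close>, so the
  inclusion test separates the two pieces again.\<close>

lemma nc_cut_join:
  assumes "a < i" "i < b" "P \<in> nc_partitions (Suc a) i" "Q \<in> nc_partitions i b"
  shows "nc_cut a i (nc_join a i (P, Q)) = (P, Q)"
proof -
  note P = nc_partitionsD[OF assms(3)] and Q = nc_partitionsD[OF assms(4)]
  let ?f = "\<lambda>B. if i \<in> B then insert a B else B"
  have Psub: "B \<subseteq> {Suc a..<i}" if "B \<in> P" for B
    using partition_on_block_subset[OF P(1) that] by simp
  have Qsub: "B \<subseteq> {i..<b}" "B \<noteq> {}" if "B \<in> Q" for B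
    using partition_on_block_subset[OF Q(1) that] .
  have n: "\<not> ?f B \<subseteq> {Suc a..<i}" if B: "B \<in> Q" for B
  proof -
    obtain x where "x \<in> B" "x \<ge> i" using Qsub[OF B] by fastforce
    then show ?thesis by (cases "i \<in> B") auto
  qed
  have d: "?f B - {a} = B" if "B \<in> Q" for B
    using Qsub[OF that] assms(1) by auto
  have 1: "{B \<in> P \<union> ?f ` Q. B \<subseteq> {Suc a..<i}} = P" using Psub n by blast
  have 2: "{B \<in> P \<union> ?f ` Q. \<not> B \<subseteq> {Suc a..<i}} = ?f ` Q" using Psub n by blast
  have 3: "(\<lambda>B. B - {a}) ` (?f ` Q) = Q"
    unfolding image_image using d by (simp cong: image_cong_simp)
  show ?thesis unfolding nc_cut_def nc_join_def prod.case 1 2 3 by simp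
qed

text \<open>A block other than that of \<open>a\<close> and \<open>i\<close>, with a point
  \<open>y\<close> in the gap and a point \<open>x\<close> beyond \<open>i\<close>, would give the
  crossing \<open>a < y < i < x\<close>.\<close>

lemma nc_second_cases:
  assumes "a < i" "i < b" "R \<in> nc_second a i b" "B \<in> R"
  shows "B \<subseteq> {Suc a..<i} \<or> a \<in> B \<and> i \<in> B \<and> B \<subseteq> insert a {i..<b} \<or> a \<notin> B \<and> i \<notin> B \<and> B \<subseteq> {i..<b}"
proof -
  from assms(3) obtain C where R: "R \<in> nc_partitions a b" and C: "C \<in> R" "a \<in> C" "i \<in> C" "C \<subseteq> insert a {i..}"
    by (auto simp: nc_second_def)
  note R = nc_partitionsD[OF R]
  have B: "B \<subseteq> {a..<b}" using partition_on_block_subset[OF R(1) assms(4)] by simp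
  show ?thesis
  proof (cases "B = C")
    case True
    then have "B \<subseteq> insert a {i..<b}" using B C by fastforce
    then show ?thesis using True C by blast
  next
    case False
    then have *: "a \<notin> B" "i \<notin> B" using partition_on_block_eq[OF R(1) assms(4) C(1)] C by auto
    show ?thesis
    proof (rule ccontr)
      assume "\<not> ?thesis"
      then obtain x y where xy: "x \<in> B" "x \<notin> {Suc a..<i}" "y \<in> B" "y \<notin> {i..<b}" using * by blast
      then have "a < y" "y < i" "x \<ge> i" using B * by (auto simp: order.order_iff_strict)
      moreover have "x \<noteq> i" using xy * by auto
      ultimately show False
        using noncrossingD[OF R(2) C(1) assms(4) C(2) xy(3) C(3) xy(1)] False by auto
    qed
  qed
qed

lemma noncrossing_subset: "noncrossing P \<Longrightarrow> Q \<subseteq> P \<Longrightarrow> noncrossing Q"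
  unfolding noncrossing_def by blast

text \<open>By \<open>nc_second_cases\<close> no block has points both inside and outside the gap,
  so the blocks inside partition it; the others, after deletion of \<open>a\<close>, partition
  \<open>{i..<b}\<close>.\<close>

lemma nc_cut_mem:
  assumes "a < i" "i < b" "R \<in> nc_second a i b"
  shows "nc_cut a i R \<in> nc_partitions (Suc a) i \<times> nc_partitions i b"
    and "nc_join a i (nc_cut a i R) = R"
proof -
  note cases = nc_second_cases[OF assms]
  have R: "R \<in> nc_partitions a b" using assms(3) by (simp add: nc_second_def)
  note R = nc_partitionsD[OF R]
  let ?P = "{B \<in> R. B \<subseteq> {Suc a..<i}}"
  let ?Q' = "{B \<in> R. \<not> B \<subseteq> {Suc a..<i}}"
  let ?Q = "(\<lambda>B. B - {a}) ` ?Q'"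
  have ne: "B \<noteq> {}" if "B \<in> R" for B using partition_on_block_subset[OF R(1) that] by simp
  have U: "\<Union>R = {a..<b}" using R by (auto simp: partition_on_def)
  have Q': "a \<in> B \<and> i \<in> B \<and> B \<subseteq> insert a {i..<b} \<or> a \<notin> B \<and> i \<notin> B \<and> B \<subseteq> {i..<b}" if "B \<in> ?Q'" for B
    using cases[of B] that by blast
  have "partition_on {Suc a..<i} ?P"
  proof (rule partition_onI)
    show "\<Union>?P = {Suc a..<i}"
    proof (intro equalityI subsetI)
      fix x assume x: "x \<in> {Suc a..<i}"
      then have "x \<in> \<Union>R" using U assms by auto
      then obtain B where B: "B \<in> R" "x \<in> B" by blast
      then have "B \<subseteq> {Suc a..<i}" using cases[OF B(1)] x by auto
      then show "x \<in> \<Union>?P" using B by blast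
    qed auto
  qed (use ne R(1) in \<open>auto simp: partition_on_def disjnt_def disjoint_def\<close>)
  moreover have "noncrossing ?P" using R(2) by (rule noncrossing_subset) auto
  moreover have "partition_on {i..<b} ?Q"
  proof (rule partition_onI)
    show "\<Union>?Q = {i..<b}"
    proof
      show "\<Union>?Q \<subseteq> {i..<b}" using Q' by blast
      show "{i..<b} \<subseteq> \<Union>?Q"
      proof
        fix x assume x: "x \<in> {i..<b}"
        then have "x \<in> \<Union>R" using U assms by auto
        then obtain B where B: "B \<in> R" "x \<in> B" by blast
        moreover have "\<not> B \<subseteq> {Suc a..<i}" using B x by auto
        ultimately show "x \<in> \<Union>?Q" using x assms by auto
      qed
    qed
    have "B - {a} \<noteq> {}" if "B \<in> ?Q'" for B using Q'[OF that] ne[of B] that assms(1) by auto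
    then show "{} \<notin> ?Q" by blast
    fix p p' assume p: "p \<in> ?Q" "p' \<in> ?Q" "p \<noteq> p'"
    then obtain B B' where "B \<in> R" "p = B - {a}" "B' \<in> R" "p' = B' - {a}" by blast
    then show "disjnt p p'" using p(3) partition_on_block_eq[OF R(1), of B B'] by (auto simp: disjnt_def)
  qed
  moreover have "noncrossing ?Q"
  proof (rule noncrossingI)
    fix B C x y z w
    assume BC: "B \<in> ?Q" "C \<in> ?Q" "B \<noteq> C" and xs: "x \<in> B" "y \<in> C" "z \<in> B" "w \<in> C" "x < y" "y < z" "z < w"
    from BC obtain B' C' where "B' \<in> R" "B = B' - {a}" "C' \<in> R" "C = C' - {a}" by blast
    then show False using noncrossingD[OF R(2), of B' C' x y z w] xs BC(3) by auto
  qed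
  ultimately show "nc_cut a i R \<in> nc_partitions (Suc a) i \<times> nc_partitions i b"
    by (simp add: nc_cut_def nc_partitions_def)
  let ?f = "\<lambda>B. if i \<in> B then insert a B else B"
  have "?f (B - {a}) = B" if "B \<in> ?Q'" for B
    using Q'[OF that] assms(1) by auto
  then have "?f ` ?Q = ?Q'" unfolding image_image by (simp cong: image_cong_simp)
  moreover have "nc_join a i (nc_cut a i R) = ?P \<union> ?f ` ?Q" by (simp add: nc_cut_def nc_join_def)
  ultimately show "nc_join a i (nc_cut a i R) = R" by auto
qed

text \<open>The case without a second element: a singleton cannot take part in a crossing, which
  needs two points of each block.\<close>

lemma nc_singleton_image:
  assumes "a < b"
  shows "{P \<in> nc_partitions a b. {a} \<in> P} = insert {a} ` nc_partitions (Suc a) b"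
proof (intro equalityI subsetI)
  have e: "{a..<b} - {a} = {Suc a..<b}" by auto
  {
    fix P assume "P \<in> {P \<in> nc_partitions a b. {a} \<in> P}"
    then have P: "partition_on {a..<b} P" "noncrossing P" "{a} \<in> P"
      by (auto simp: nc_partitions_def)
    have "disjnt {a} (\<Union>(P - {{a}}))"
      using partition_on_block_eq[OF P(1,3)] by (auto simp: disjnt_def)
    moreover have i: "P = insert {a} (P - {{a}})" using P by auto
    ultimately have "partition_on {Suc a..<b} (P - {{a}})"
      using P(1) partition_on_insert[of "{a}" "P - {{a}}" "{a..<b}"] e by simp
    moreover have "noncrossing (P - {{a}})" using P(2) by (rule noncrossing_subset) auto
    ultimately show "P \<in> insert {a} ` nc_partitions (Suc a) b"
      using i by (intro image_eqI[of _ _ "P - {{a}}"]) (auto simp: nc_partitions_def)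
  next
    fix P assume "P \<in> insert {a} ` nc_partitions (Suc a) b"
    then obtain P' where P: "P = insert {a} P'" "partition_on {Suc a..<b} P'" "noncrossing P'"
      by (auto simp: nc_partitions_def)
    have sub: "B \<subseteq> {Suc a..<b}" if "B \<in> P'" for B using partition_on_block_subset[OF P(2) that] by simp
    then have "disjnt {a} (\<Union>P')" by (fastforce simp: disjnt_def)
    then have "partition_on {a..<b} P"
      using P partition_on_insert[of "{a}" P' "{a..<b}"] e assms by simp
    moreover have "noncrossing P"
    proof (rule noncrossingI)
      fix B C x y z w
      assume *: "B \<in> P" "C \<in> P" "x \<in> B" "y \<in> C" "z \<in> B" "w \<in> C" "x < y" "y < z" "z < w" "B \<noteq> C"
      then have "B \<noteq> {a}" "C \<noteq> {a}" by auto
      then show False using * noncrossingD[OF P(3), of B C x y z w] P(1) by auto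
    qed
    ultimately show "P \<in> {P \<in> nc_partitions a b. {a} \<in> P}"
      using P by (simp add: nc_partitions_def)
  }
qed

lemma nc_partitions_split:
  assumes "a < b"
  shows "nc_partitions a b =
    {P \<in> nc_partitions a b. {a} \<in> P} \<union> (\<Union>i\<in>{a<..<b}. nc_second a i b)"
proof (intro equalityI subsetI)
  fix P assume P: "P \<in> nc_partitions a b"
  note P' = nc_partitionsD[OF P]
  obtain B where B: "B \<in> P" "a \<in> B" using partition_on_block_ex[OF P'(1), of a] assms by auto
  have sub: "B \<subseteq> {a..<b}" using partition_on_block_subset[OF P'(1) B(1)] by simp
  then have fin: "finite B" using finite_subset by blast
  show "P \<in> {P \<in> nc_partitions a b. {a} \<in> P} \<union> (\<Union>i\<in>{a<..<b}. nc_second a i b)"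
  proof (cases "B = {a}")
    case True
    then show ?thesis using B P by auto
  next
    case False
    define i where "i = Min (B - {a})"
    have ne: "B - {a} \<noteq> {}" using False B by auto
    have i: "i \<in> B - {a}" unfolding i_def using fin ne by (intro Min_in) auto
    have "B \<subseteq> insert a {i..}" using fin by (auto simp: i_def)
    moreover have "i \<in> {a<..<b}" using i sub by (auto simp: order.order_iff_strict)
    ultimately show ?thesis using B i P by (auto simp: nc_second_def)
  qed
qed (auto simp: nc_second_def)

lemma nc_second_disjoint:
  assumes "P \<in> nc_second a i b" "P \<in> nc_second a j b" "a < i" "a < j"
  shows "i = j"
proof -
  from assms(1) obtain B where P: "P \<in> nc_partitions a b" and B: "B \<in> P" "a \<in> B" "i \<in> B" "B \<subseteq> insert a {i..}"
    by (auto simp: nc_second_def)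
  from assms(2) obtain C where C: "C \<in> P" "a \<in> C" "j \<in> C" "C \<subseteq> insert a {j..}"
    by (auto simp: nc_second_def)
  have "B = C" using partition_on_block_eq[OF nc_partitionsD(1)[OF P]] B C by blast
  then have "i \<ge> j" "j \<ge> i" using B C assms(3,4) by auto
  then show ?thesis by simp
qed

lemma nc_second_not_singleton:
  assumes "P \<in> nc_second a i b" "a < i"
  shows "{a} \<notin> P"
proof
  assume a: "{a} \<in> P"
  from assms(1) obtain B where P: "P \<in> nc_partitions a b" and B: "B \<in> P" "a \<in> B" "i \<in> B"
    by (auto simp: nc_second_def)
  have "B = {a}" using partition_on_block_eq[OF nc_partitionsD(1)[OF P] B(1) a] B by blast
  then show False using B assms by auto
qed

text \<open>In the right piece the block of \<open>i\<close> has lost \<open>a\<close>, hence the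
  shift \<open>Suc s\<close>; the left piece consists of complete blocks.\<close>

lemma nc_second_sum:
  assumes "a < i" "i < b"
  shows "(\<Sum>P\<in>nc_second a i b. \<Prod>B\<in>P. if a \<in> B then c (card B + s) else u (Min B) * c (card B))
    = nc_sum u c (Suc a) i * nc_shift_sum u c (Suc s) i b"
proof -
  let ?w = "\<lambda>B. if a \<in> B then c (card B + s) else u (Min B) * c (card B)"
  let ?v = "\<lambda>B. if i \<in> B then c (card B + Suc s) else u (Min B) * c (card B)"
  have w: "prod ?w (nc_join a i (P, Q)) = (\<Prod>B\<in>P. u (Min B) * c (card B)) * prod ?v Q"
    if "P \<in> nc_partitions (Suc a) i" "Q \<in> nc_partitions i b" for P Q
  proof -
    note P = nc_partitionsD[OF that(1)] and Q = nc_partitionsD[OF that(2)]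
    let ?f = "\<lambda>B. if i \<in> B then insert a B else B"
    have Psub: "B \<subseteq> {Suc a..<i}" "B \<noteq> {}" if "B \<in> P" for B
      using partition_on_block_subset[OF P(1) that] by simp_all
    have Qsub: "B \<subseteq> {i..<b}" "B \<noteq> {}" if "B \<in> Q" for B
      using partition_on_block_subset[OF Q(1) that] .
    have d: "?f B - {a} = B" if "B \<in> Q" for B
      using Qsub[OF that] assms(1) by auto
    have inj: "inj_on ?f Q" using d by (metis (no_types, lifting) inj_onI)
    have "P \<inter> ?f ` Q = {}"
    proof -
      have False if B: "B \<in> P" "?f C = B" and C: "C \<in> Q" for B C
      proof -
        obtain x where "x \<in> C" using Qsub[OF C] by blast
        then have "x \<in> B" "x \<ge> i" using B Qsub[OF C] by (auto split: if_splits)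
        then show False using Psub[OF B(1)] by auto
      qed
      then show ?thesis by blast
    qed
    then have "prod ?w (nc_join a i (P, Q)) = prod ?w P * prod ?w (?f ` Q)"
      unfolding nc_join_def prod.case using P Q by (intro prod.union_disjoint) auto
    also have "prod ?w P = (\<Prod>B\<in>P. u (Min B) * c (card B))"
      using Psub by (intro prod.cong) fastforce+
    also have "prod ?w (?f ` Q) = prod ?v Q"
      unfolding prod.reindex[OF inj]
    proof (intro prod.cong refl)
      fix B assume B: "B \<in> Q"
      have "a \<notin> B" using Qsub[OF B] assms by auto
      moreover have "finite B" using Qsub[OF B] finite_subset by blast
      ultimately show "(?w \<circ> ?f) B = ?v B" by simp
    qed
    finally show ?thesis .
  qed
  have "(\<Sum>P\<in>nc_second a i b. prod ?w P)
    = (\<Sum>x\<in>nc_partitions (Suc a) i \<times> nc_partitions i b. prod ?w (nc_join a i x))"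
    by (rule sum.reindex_bij_witness[where i = "nc_join a i" and j = "nc_cut a i"])
       (use nc_cut_mem[OF assms] nc_join_mem[OF assms] nc_cut_join[OF assms] in auto)
  also have "\<dots> = (\<Sum>(P,Q)\<in>nc_partitions (Suc a) i \<times> nc_partitions i b.
      (\<Prod>B\<in>P. u (Min B) * c (card B)) * prod ?v Q)"
    using w by (intro sum.cong) auto
  finally show ?thesis
    by (simp add: nc_sum_def nc_shift_sum_def sum_product sum.cartesian_product)
qed

text \<open>The first term is the singleton block of \<open>a\<close>, counted with size
  \<open>Suc s\<close>; the sum sorts the other partitions by the second element \<open>i\<close> of
  that block.\<close>

lemma nc_shift_sum_rec:
  assumes "a < b"
  shows "nc_shift_sum u c s a b = c (Suc s) * nc_sum u c (Suc a) b
    + (\<Sum>i\<in>{a<..<b}. nc_sum u c (Suc a) i * nc_shift_sum u c (Suc s) i b)"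
proof -
  let ?w = "\<lambda>B. if a \<in> B then c (card B + s) else u (Min B) * c (card B)"
  have fin: "finite (nc_second a i b)" for i
    using finite_nc_partitions[of a b] by (rule rev_finite_subset) (auto simp: nc_second_def)
  have Psub: "B \<subseteq> {Suc a..<b}" if "P \<in> nc_partitions (Suc a) b" "B \<in> P" for P B
    using partition_on_block_subset[OF nc_partitionsD(1)[OF that(1)] that(2)] by simp
  have na: "a \<notin> B" if "P \<in> nc_partitions (Suc a) b" "B \<in> P" for P B
    using Psub[OF that] by auto
  have inj: "inj_on (insert {a}) (nc_partitions (Suc a) b)"
  proof (rule inj_onI)
    fix P Q assume PQ: "P \<in> nc_partitions (Suc a) b" "Q \<in> nc_partitions (Suc a) b" "insert {a} P = insert {a} Q"
    have "{a} \<notin> P" "{a} \<notin> Q" using na PQ by blast+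
    then show "P = Q" using PQ(3) by (simp add: insert_ident)
  qed
  have "nc_shift_sum u c s a b = (\<Sum>P | P \<in> nc_partitions a b \<and> {a} \<in> P. prod ?w P)
     + (\<Sum>P\<in>(\<Union>i\<in>{a<..<b}. nc_second a i b). prod ?w P)"
    unfolding nc_shift_sum_def
    by (subst nc_partitions_split[OF assms], rule sum.union_disjoint)
       (use finite_nc_partitions fin in \<open>auto dest: nc_second_not_singleton\<close>)
  also have "(\<Sum>P\<in>(\<Union>i\<in>{a<..<b}. nc_second a i b). prod ?w P)
     = (\<Sum>i\<in>{a<..<b}. \<Sum>P\<in>nc_second a i b. prod ?w P)"
    using fin by (intro sum.UNION_disjoint) (auto dest: nc_second_disjoint)
  also have "\<dots> = (\<Sum>i\<in>{a<..<b}. nc_sum u c (Suc a) i * nc_shift_sum u c (Suc s) i b)"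
    by (intro sum.cong nc_second_sum) auto
  also have "(\<Sum>P | P \<in> nc_partitions a b \<and> {a} \<in> P. prod ?w P)
     = (\<Sum>P\<in>nc_partitions (Suc a) b. prod ?w (insert {a} P))"
    unfolding nc_singleton_image[OF assms] by (subst sum.reindex[OF inj]) simp
  also have "\<dots> = (\<Sum>P\<in>nc_partitions (Suc a) b. c (Suc s) * (\<Prod>B\<in>P. u (Min B) * c (card B)))"
  proof (intro sum.cong refl)
    fix P assume P: "P \<in> nc_partitions (Suc a) b"
    have "prod ?w (insert {a} P) = ?w {a} * prod ?w P"
      using nc_partitionsD(3)[OF P] na[OF P] by (intro prod.insert) auto
    also have "prod ?w P = (\<Prod>B\<in>P. u (Min B) * c (card B))"
      using na[OF P] by (intro prod.cong) auto
    finally show "prod ?w (insert {a} P) = c (Suc s) * (\<Prod>B\<in>P. u (Min B) * c (card B))" by simp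
  qed
  finally show ?thesis by (simp add: nc_sum_def sum_distrib_left)
qed

lemma nc_sum_eq_shift_sum:
  assumes "a < b"
  shows "nc_sum u c a b = u a * nc_shift_sum u c 0 a b"
  unfolding nc_sum_def nc_shift_sum_def sum_distrib_left
proof (intro sum.cong refl)
  fix P assume "P \<in> nc_partitions a b"
  note P = nc_partitionsD[OF this]
  obtain B where B: "B \<in> P" "a \<in> B" using partition_on_block_ex[OF P(1), of a] assms by auto
  have sub: "B \<subseteq> {a..<b}" using partition_on_block_subset[OF P(1) B(1)] by simp
  then have "Min B = a" using B by (intro Min_eqI) (auto intro: finite_subset)
  moreover have "a \<notin> C" if "C \<in> P - {B}" for C
    using partition_on_block_eq[OF P(1) B(1)] that B by blast
  ultimately show "(\<Prod>B\<in>P. u (Min B) * c (card B))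
    = u a * (\<Prod>B\<in>P. if a \<in> B then c (card B + 0) else u (Min B) * c (card B))"
    using B by (simp add: prod.remove[OF P(3) B(1)])
qed

lemma nc_sum_empty [simp]: "nc_sum u c a a = 1"
  by (simp add: nc_sum_def)

section \<open>Lukasiewicz paths\<close>

text \<open>
  \<open>path_sum A W n i\<close> runs over the paths of \<open>n\<close> steps from height \<open>0\<close> to \<open>i\<close>: \<open>A h\<close> is the weight of the
  descent from \<open>h + 1\<close> to \<open>h\<close>, and \<open>W h j\<close> that of the ascent from \<open>h\<close> to \<open>h + j\<close>.
\<close>

primrec path_sum :: "(nat \<Rightarrow> real) \<Rightarrow> (nat \<Rightarrow> nat \<Rightarrow> real) \<Rightarrow> nat \<Rightarrow> nat \<Rightarrow> real" where
  "path_sum A W 0 i = (if i = 0 then 1 else 0)"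
| "path_sum A W (Suc n) i = A i * path_sum A W n (Suc i) + (\<Sum>j\<le>i. W (i - j) j * path_sum A W n (i - j))"

text \<open>
  \<open>descent_sum u c n a h\<close> runs over the paths of \<open>n\<close> steps from height \<open>h\<close> to \<open>0\<close> whose steps are numbered
  from \<open>a\<close>: descents have weight \<open>1\<close>, and an ascent by \<open>j\<close> in step \<open>t\<close> opens a block of size \<open>j + 1\<close> with
  minimum \<open>t\<close>.
\<close>

primrec descent_sum :: "(nat \<Rightarrow> real) \<Rightarrow> (nat \<Rightarrow> real) \<Rightarrow> nat \<Rightarrow> nat \<Rightarrow> nat \<Rightarrow> real" where
  "descent_sum u c 0 a h = (if h = 0 then 1 else 0)"
| "descent_sum u c (Suc n) a h = (case h of 0 \<Rightarrow> 0 | Suc h' \<Rightarrow> descent_sum u c n (Suc a) h')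
     + u a * (\<Sum>j\<le>n. c (Suc j) * descent_sum u c n (Suc a) (h + j))"

lemma descent_sum_eq_0: "n < h \<Longrightarrow> descent_sum u c n a h = 0"
  by (induction n arbitrary: a h) (auto split: nat.split intro!: sum.neutral)

text \<open>A bound \<open>N\<close> common to all lengths allows the sums over lengths and over
  ascents to be exchanged.\<close>

lemma descent_sum_Suc_extend:
  assumes "n \<le> N"
  shows "descent_sum u c (Suc n) a h = (case h of 0 \<Rightarrow> 0 | Suc h' \<Rightarrow> descent_sum u c n (Suc a) h')
     + u a * (\<Sum>j\<le>N. c (Suc j) * descent_sum u c n (Suc a) (h + j))"
proof -
  have "(\<Sum>j\<le>n. c (Suc j) * descent_sum u c n (Suc a) (h + j))
    = (\<Sum>j\<le>N. c (Suc j) * descent_sum u c n (Suc a) (h + j))"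
    using assms by (intro sum.mono_neutral_left) (auto simp: descent_sum_eq_0)
  then show ?thesis by simp
qed

text \<open>Cut at the first visit to height \<open>h\<close>: the first \<open>i\<close> steps go
  from \<open>j\<close> to \<open>0\<close> relative to level \<open>h + 1\<close>, step
  \<open>a + i\<close> is a descent of weight \<open>1\<close>, and the rest starts at
  \<open>h\<close>.\<close>

lemma descent_sum_first_passage:
  "descent_sum u c n a (Suc (h + j)) =
     (\<Sum>i<n. descent_sum u c i a j * descent_sum u c (n - Suc i) (Suc (a + i)) h)"
proof (induction n arbitrary: a j)
  case 0
  then show ?case by simp
next
  case (Suc n)
  let ?D = "descent_sum u c"
  let ?R = "\<lambda>i. ?D (n - Suc i) (Suc (Suc (a + i))) h"
  have IH: "?D n (Suc a) (Suc (h + j)) = (\<Sum>i<n. ?D i (Suc a) j * ?R i)" for j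
    using Suc.IH[of "Suc a"] by simp
  have "(\<Sum>i<Suc n. ?D i a j * ?D (Suc n - Suc i) (Suc (a + i)) h)
    = ?D 0 a j * ?D n (Suc a) h + (\<Sum>i<n. ?D (Suc i) a j * ?R i)"
    by (subst sum.lessThan_Suc_shift) simp
  also have "(\<Sum>i<n. ?D (Suc i) a j * ?R i)
    = (\<Sum>i<n. (case j of 0 \<Rightarrow> 0 | Suc h' \<Rightarrow> ?D i (Suc a) h') * ?R i)
      + (\<Sum>i<n. u a * (\<Sum>t\<le>n. c (Suc t) * ?D i (Suc a) (j + t)) * ?R i)"
    unfolding sum.distrib[symmetric]
    by (intro sum.cong refl, subst descent_sum_Suc_extend[of _ n]) (auto simp: distrib_right)
  also have "(\<Sum>i<n. u a * (\<Sum>t\<le>n. c (Suc t) * ?D i (Suc a) (j + t)) * ?R i)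
    = u a * (\<Sum>t\<le>n. c (Suc t) * (\<Sum>i<n. ?D i (Suc a) (j + t) * ?R i))"
    unfolding sum_distrib_left sum_distrib_right
    by (subst sum.swap) (simp add: mult_ac)
  also have "\<dots> = u a * (\<Sum>t\<le>n. c (Suc t) * ?D n (Suc a) (Suc (h + (j + t))))"
    by (simp only: IH)
  finally have R: "(\<Sum>i<Suc n. ?D i a j * ?D (Suc n - Suc i) (Suc (a + i)) h)
    = ?D 0 a j * ?D n (Suc a) h + ((\<Sum>i<n. (case j of 0 \<Rightarrow> 0 | Suc h' \<Rightarrow> ?D i (Suc a) h') * ?R i)
      + u a * (\<Sum>t\<le>n. c (Suc t) * ?D n (Suc a) (Suc (h + (j + t)))))" .
  \<comment> \<open>These are the paths that begin with a descent; for \<open>j = 0\<close> it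
    already reaches \<open>h\<close>, and only the first term is left.\<close>
  have "?D 0 a j * ?D n (Suc a) h + (\<Sum>i<n. (case j of 0 \<Rightarrow> 0 | Suc h' \<Rightarrow> ?D i (Suc a) h') * ?R i)
    = ?D n (Suc a) (h + j)"
    by (cases j) (simp_all add: IH)
  then show ?case unfolding R by (simp add: add.assoc)
qed

text \<open>A joint induction: the first claim isolates the block of \<open>a\<close>, the second
  cuts this block at its second element. An ascent by \<open>j\<close> leaves \<open>j\<close>
  elements of the new block to come.\<close>

lemma nc_sum_eq_descent_sum_aux:
  "(\<forall>a. nc_sum u c a (a + n) = descent_sum u c n a 0) \<and>
   (\<forall>a s. nc_shift_sum u c s a (a + Suc n) = (\<Sum>j\<le>n. c (Suc (j + s)) * descent_sum u c n (Suc a) j))"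
proof (induction n rule: less_induct)
  case (less n)
  let ?D = "descent_sum u c"
  have A: "nc_sum u c a (a + n) = ?D n a 0" for a
  proof (cases n)
    case (Suc m)
    then have "nc_shift_sum u c 0 a (a + n) = (\<Sum>j\<le>m. c (Suc j) * ?D m (Suc a) j)"
      using less[of m] by simp
    then show ?thesis using Suc by (simp add: nc_sum_eq_shift_sum)
  qed simp
  have B: "nc_shift_sum u c s a (a + Suc n) = (\<Sum>j\<le>n. c (Suc (j + s)) * ?D n (Suc a) j)" for a s
  proof -
    \<comment> \<open>The second element is \<open>a + i + 1\<close>, with \<open>i\<close> points
      in the gap before it.\<close>
    have "{a<..<a + Suc n} = (\<lambda>i. Suc (a + i)) ` {..<n}"
      by (auto simp: image_iff dest!: less_imp_Suc_add)
    then have "(\<Sum>i\<in>{a<..<a + Suc n}. nc_sum u c (Suc a) i * nc_shift_sum u c (Suc s) i (a + Suc n))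
      = (\<Sum>i<n. nc_sum u c (Suc a) (Suc (a + i)) * nc_shift_sum u c (Suc s) (Suc (a + i)) (a + Suc n))"
      by (simp add: sum.reindex inj_on_def)
    also have "\<dots> = (\<Sum>i<n. ?D i (Suc a) 0 * (\<Sum>j\<le>n. c (Suc (Suc (j + s))) * ?D (n - Suc i) (Suc (Suc (a + i))) j))"
    proof (intro sum.cong refl arg_cong2[where f = "(*)"])
      fix i assume i: "i \<in> {..<n}"
      show "nc_sum u c (Suc a) (Suc (a + i)) = ?D i (Suc a) 0"
        using less[of i] i by (auto dest!: spec[of _ "Suc a"])
      have e: "a + Suc n = Suc (a + i) + Suc (n - Suc i)" using i by auto
      have "nc_shift_sum u c (Suc s) (Suc (a + i)) (a + Suc n)
        = (\<Sum>j\<le>n - Suc i. c (Suc (j + Suc s)) * ?D (n - Suc i) (Suc (Suc (a + i))) j)"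
        unfolding e by (rule less[THEN conjunct2, rule_format]) (use i in auto)
      also have "\<dots> = (\<Sum>j\<le>n. c (Suc (Suc (j + s))) * ?D (n - Suc i) (Suc (Suc (a + i))) j)"
        by (rule sum.mono_neutral_cong_left) (auto simp: descent_sum_eq_0)
      finally show "nc_shift_sum u c (Suc s) (Suc (a + i)) (a + Suc n)
        = (\<Sum>j\<le>n. c (Suc (Suc (j + s))) * ?D (n - Suc i) (Suc (Suc (a + i))) j)" .
    qed
    also have "\<dots> = (\<Sum>j\<le>n. c (Suc (Suc (j + s))) * (\<Sum>i<n. ?D i (Suc a) 0 * ?D (n - Suc i) (Suc (Suc a + i)) j))"
      unfolding sum_distrib_left by (subst sum.swap) (simp add: mult_ac)
    \<comment> \<open>The gap together with the second element is a first passage from height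
      \<open>j + 1\<close> to \<open>j\<close>.\<close>
    also have "\<dots> = (\<Sum>j\<le>n. c (Suc (Suc (j + s))) * ?D n (Suc a) (Suc j))"
      using descent_sum_first_passage[of u c n "Suc a" _ 0] by simp
    finally have *: "(\<Sum>i\<in>{a<..<a + Suc n}. nc_sum u c (Suc a) i * nc_shift_sum u c (Suc s) i (a + Suc n))
      = (\<Sum>j\<le>n. c (Suc (Suc (j + s))) * ?D n (Suc a) (Suc j))" .
    have "nc_shift_sum u c s a (a + Suc n) = c (Suc s) * nc_sum u c (Suc a) (a + Suc n)
       + (\<Sum>j\<le>n. c (Suc (Suc (j + s))) * ?D n (Suc a) (Suc j))"
      using nc_shift_sum_rec[of a "a + Suc n"] * by simp
    also have "nc_sum u c (Suc a) (a + Suc n) = ?D n (Suc a) 0"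
      using A[of "Suc a"] by simp
    also have "c (Suc s) * ?D n (Suc a) 0 + (\<Sum>j\<le>n. c (Suc (Suc (j + s))) * ?D n (Suc a) (Suc j))
      = (\<Sum>j\<le>Suc n. c (Suc (j + s)) * ?D n (Suc a) j)"
      by (subst sum.atMost_Suc_shift) simp
    \<comment> \<open>The top term vanishes: \<open>n\<close> steps cannot descend from height
      \<open>n + 1\<close>.\<close>
    also have "\<dots> = (\<Sum>j\<le>n. c (Suc (j + s)) * ?D n (Suc a) j)"
      by (simp add: descent_sum_eq_0)
    finally show ?thesis .
  qed
  show ?case using A B by blast
qed

lemma nc_sum_eq_descent_sum: "nc_sum u c a (a + n) = descent_sum u c n a 0"
  using nc_sum_eq_descent_sum_aux by blast

text \<open>A path is split at time \<open>n\<close>, with \<open>F\<close> before and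
  \<open>descent_sum\<close> after. The total does not depend on the splitting time: the induction
  moves one step from one factor to the other.\<close>

lemma path_sum_descent_sum_pairing:
  fixes F :: "nat \<Rightarrow> nat \<Rightarrow> real"
  assumes F0: "\<And>i. F 0 i = (if i = 0 then 1 else 0)"
    and F: "\<And>n i. F (Suc n) i = F n (Suc i) + u (Suc n) * (\<Sum>j\<le>i. c (Suc j) * F n (i - j))"
  shows "(\<Sum>h\<le>m. F n h * descent_sum u c m (Suc n) h) = descent_sum u c (n + m) 1 0"
proof (induction n arbitrary: m)
  case 0
  have "(\<Sum>h\<le>m. F 0 h * descent_sum u c m (Suc 0) h)
    = (\<Sum>h\<in>{0}. F 0 h * descent_sum u c m (Suc 0) h)"
    by (rule sum.mono_neutral_right) (auto simp: F0)
  then show ?case by (simp add: F0)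
next
  case (Suc n)
  let ?D = "descent_sum u c m (Suc (Suc n))"
  have "(\<Sum>h\<le>m. (\<Sum>j\<le>h. c (Suc j) * F n (h - j)) * ?D h)
    = (\<Sum>h\<le>m. \<Sum>j\<le>h. c (Suc j) * F n (h - j) * ?D (j + (h - j)))"
    by (simp add: sum_distrib_right)
  also have "\<dots> = (\<Sum>(j, h)\<in>{(j, h). j + h \<le> m}. c (Suc j) * F n h * ?D (j + h))"
    by (rule sum.triangle_reindex_eq[symmetric])
  \<comment> \<open>The triangle is enlarged to a rectangle; at the added pairs the height exceeds
    the \<open>m\<close> remaining steps.\<close>
  also have "\<dots> = (\<Sum>(j, h)\<in>{..m} \<times> {..Suc m}. c (Suc j) * F n h * ?D (j + h))"
    by (rule sum.mono_neutral_left) (auto intro: ccontr simp: not_le descent_sum_eq_0)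
  also have "\<dots> = (\<Sum>h\<le>Suc m. F n h * (\<Sum>j\<le>m. c (Suc j) * ?D (h + j)))"
    unfolding sum.cartesian_product[symmetric]
    by (subst sum.swap) (simp add: sum_distrib_left mult_ac add_ac del: sum.atMost_Suc)
  finally have tri: "(\<Sum>h\<le>m. (\<Sum>j\<le>h. c (Suc j) * F n (h - j)) * ?D h)
    = (\<Sum>h\<le>Suc m. F n h * (\<Sum>j\<le>m. c (Suc j) * ?D (h + j)))" .
  have "(\<Sum>h\<le>m. F (Suc n) h * ?D h)
    = (\<Sum>h\<le>m. F n (Suc h) * ?D h) + u (Suc n) * (\<Sum>h\<le>m. (\<Sum>j\<le>h. c (Suc j) * F n (h - j)) * ?D h)"
    by (simp only: F distrib_right mult.assoc sum.distrib sum_distrib_left[symmetric])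
  also have "(\<Sum>h\<le>m. F n (Suc h) * ?D h) = (\<Sum>h\<le>Suc m. F n h * (case h of 0 \<Rightarrow> 0 | Suc h' \<Rightarrow> ?D h'))"
    by (subst sum.atMost_Suc_shift) simp
  also have "\<dots> + u (Suc n) * (\<Sum>h\<le>m. (\<Sum>j\<le>h. c (Suc j) * F n (h - j)) * ?D h)
    = (\<Sum>h\<le>Suc m. F n h * descent_sum u c (Suc m) (Suc n) h)"
    unfolding tri sum_distrib_left sum.distrib[symmetric]
    by (intro sum.cong refl) (simp add: algebra_simps sum_distrib_left)
  also have "\<dots> = descent_sum u c (n + Suc m) 1 0" by (rule Suc.IH)
  finally show ?case by simp
qed

lemma path_sum_parity:
  assumes "\<And>h j. even j \<Longrightarrow> W h j = 0"
  shows "odd (n + i) \<Longrightarrow> path_sum A W n i = 0"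
proof (induction n arbitrary: i)
  case 0
  then show ?case by (auto simp: odd_pos)
next
  case (Suc n)
  have "W (i - j) j * path_sum A W n (i - j) = 0" if "j \<le> i" for j
    using Suc assms[of j] that by (cases "even j") auto
  then show ?case using Suc by (auto intro!: sum.neutral)
qed

text \<open>Ascents by \<open>2p - 1\<close> belong to cumulants of index \<open>2p\<close>, which
  \<open>x\<close> lists by \<open>p\<close>; \<open>w\<close> is the extra factor at odd heights,
  \<open>1 / q\<close> or \<open>0\<close> in the limits.\<close>

definition two_step_weight :: "(nat \<Rightarrow> real) \<Rightarrow> real \<Rightarrow> nat \<Rightarrow> nat \<Rightarrow> real" where
  "two_step_weight x w h j = (if odd j then x (Suc j div 2) * (if even h then 1 else w) else 0)"

text \<open>The link is \<open>descent_sum\<close>, where an ascent at time \<open>t\<close> opens a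
  block with minimum \<open>t\<close>. Blocks of odd size have weight \<open>0\<close>, which leaves
  \<open>NC_even\<close>.\<close>

lemma path_sum_eq_rect_free_moment:
  "path_sum (\<lambda>_. 1) (two_step_weight x (1 / q)) (2 * k) 0
    = rect_free_moment q (\<lambda>l. if even l then x (l div 2) else 0) k"
proof -
  define c where "c l = (if even l then x (l div 2) else 0)" for l
  define u where "u l = (if even l then 1 / q else 1)" for l :: nat
  define F where "F = path_sum (\<lambda>_. 1) (two_step_weight x (1 / q))"
  \<comment> \<open>Heights and times have the same parity, so weighting by height is weighting by the minimum of a block.\<close>
  have par: "F n i = 0" if "odd (n + i)" for n i
    unfolding F_def by (rule path_sum_parity[OF _ that]) (auto simp: two_step_weight_def)
  have F: "F (Suc n) i = F n (Suc i) + u (Suc n) * (\<Sum>j\<le>i. c (Suc j) * F n (i - j))" for n i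
  proof -
    have "two_step_weight x (1 / q) (i - j) j * F n (i - j) = u (Suc n) * (c (Suc j) * F n (i - j))"
      if "j \<le> i" for j
      using par[of n "i - j"] by (auto simp: two_step_weight_def c_def u_def)
    then have "(\<Sum>j\<le>i. two_step_weight x (1 / q) (i - j) j * F n (i - j))
      = u (Suc n) * (\<Sum>j\<le>i. c (Suc j) * F n (i - j))"
      unfolding sum_distrib_left by (intro sum.cong) auto
    then show ?thesis by (simp add: F_def)
  qed
  \<comment> \<open>The pairing at the final time, where the second part is empty and only height
    \<open>0\<close> remains.\<close>
  have "F (2 * k) 0 = (\<Sum>h\<le>0. F (2 * k) h * descent_sum u c 0 (Suc (2 * k)) h)" by simp
  also have "\<dots> = descent_sum u c (2 * k + 0) 1 0"
    by (rule path_sum_descent_sum_pairing) (use F in \<open>auto simp: F_def\<close>)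
  also have "\<dots> = nc_sum u c 1 (1 + 2 * k)"
    by (simp add: nc_sum_eq_descent_sum del: One_nat_def)
  also have "\<dots> = (\<Sum>P\<in>NC_even (2 * k). \<Prod>B\<in>P. u (Min B) * c (card B))"
    unfolding nc_sum_def
  proof (rule sum.mono_neutral_right[OF finite_nc_partitions])
    have e: "{1..<1 + 2 * k} = {1..2 * k}" by auto
    show "NC_even (2 * k) \<subseteq> nc_partitions 1 (1 + 2 * k)"
      unfolding nc_partitions_def e by (auto simp: NC_even_def)
    show "\<forall>P\<in>nc_partitions 1 (1 + 2 * k) - NC_even (2 * k). (\<Prod>B\<in>P. u (Min B) * c (card B)) = 0"
    proof
      fix P assume P: "P \<in> nc_partitions 1 (1 + 2 * k) - NC_even (2 * k)"
      then have "\<exists>B\<in>P. odd (card B)" unfolding nc_partitions_def e by (auto simp: NC_even_def)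
      moreover have "finite P" using P nc_partitionsD(3) by blast
      ultimately show "(\<Prod>B\<in>P. u (Min B) * c (card B)) = 0"
        by (auto simp: prod_zero_iff c_def)
    qed
  qed
  also have "\<dots> = rect_free_moment q c k"
    unfolding rect_free_moment_def
  proof (intro sum.cong refl)
    fix P assume "P \<in> NC_even (2 * k)"
    then have "finite P" using finite_elements[of "{1..2 * k}" P] by (auto simp: NC_even_def)
    then have "(\<Prod>B\<in>P. u (Min B)) = (1 / q) ^ even_min_blocks P"
      by (simp add: u_def even_min_blocks_def prod.If_cases Int_def del: One_nat_def)
    then show "(\<Prod>B\<in>P. u (Min B) * c (card B)) = (1 / q) ^ even_min_blocks P * (\<Prod>B\<in>P. c (card B))"
      by (simp add: prod.distrib)
  qed
  finally show ?thesis by (simp add: F_def c_def[abs_def])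
qed

section \<open>Set partitions and usual cumulants\<close>

definition partition_sum :: "(nat \<Rightarrow> real) \<Rightarrow> 'a set \<Rightarrow> real" where
  "partition_sum \<kappa> A = (\<Sum>P | partition_on A P. \<Prod>B\<in>P. \<kappa> (card B))"

lemma partition_sum_insert:
  assumes "finite A" "x \<notin> A"
  shows "partition_sum \<kappa> (insert x A) = (\<Sum>S\<in>Pow A. \<kappa> (Suc (card S)) * partition_sum \<kappa> (A - S))"
proof -
  let ?I = "Sigma (Pow A) (\<lambda>S. {P. partition_on (A - S) P})"
  let ?i = "\<lambda>(S, P). insert (insert x S) P"
  \<comment> \<open>The union names the unique block containing \<open>x\<close> without a choice
    operator.\<close>
  let ?j = "\<lambda>P. (\<Union>{B \<in> P. x \<in> B} - {x}, P - {\<Union>{B \<in> P. x \<in> B}})"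
  have j: "?j P \<in> ?I" "?i (?j P) = P"
    "(\<Prod>B\<in>P. \<kappa> (card B)) = (case ?j P of (S, Q) \<Rightarrow> \<kappa> (Suc (card S)) * (\<Prod>B\<in>Q. \<kappa> (card B)))"
    if P: "partition_on (insert x A) P" for P
  proof -
    obtain B where B: "B \<in> P" "x \<in> B" using partition_on_block_ex[OF P, of x] by auto
    then have U: "\<Union>{B \<in> P. x \<in> B} = B"
      using partition_on_block_eq[OF P B(1)] by blast
    have Bsub: "B \<subseteq> insert x A" using partition_on_block_subset[OF P B(1)] by simp
    have finB: "finite B" using Bsub assms(1) finite_subset by blast
    have fin: "finite P" using finite_elements[OF _ P] assms(1) by simp
    have "disjnt B (\<Union>(P - {B}))" using partition_on_block_eq[OF P B(1)] by (auto simp: disjnt_def)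
    moreover have e: "insert B (P - {B}) = P" using B by auto
    ultimately have "partition_on (insert x A - B) (P - {B})"
      using partition_on_insert[of B "P - {B}" "insert x A"] P by simp
    moreover have "insert x A - B = A - (B - {x})" using B assms(2) by auto
    ultimately show "?j P \<in> ?I" unfolding U using Bsub by auto
    have "insert x (B - {x}) = B" using B by auto
    then show "?i (?j P) = P" unfolding U using e by simp
    show "(\<Prod>B\<in>P. \<kappa> (card B)) = (case ?j P of (S, Q) \<Rightarrow> \<kappa> (Suc (card S)) * (\<Prod>B\<in>Q. \<kappa> (card B)))"
      unfolding U using prod.remove[OF fin B(1), of "\<lambda>B. \<kappa> (card B)"] card.remove[OF finB B(2)] by simp
  qed
  have i: "?i z \<in> {P. partition_on (insert x A) P}" "?j (?i z) = z" if zI: "z \<in> ?I" for z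
  proof -
    obtain S P where z: "z = (S, P)" "S \<subseteq> A" "partition_on (A - S) P" using zI by auto
    have P: "B \<subseteq> A - S" if "B \<in> P" for B using partition_on_block_subset[OF z(3) that] by simp
    have "disjnt (insert x S) (\<Union>P)" using P assms(2) by (fastforce simp: disjnt_def)
    moreover have "insert x A - insert x S = A - S" using assms(2) by auto
    ultimately show "?i z \<in> {P. partition_on (insert x A) P}"
      using z partition_on_insert[of "insert x S" P "insert x A"] by auto
    have nx: "x \<notin> B" if "B \<in> P" for B using P[OF that] assms(2) by auto
    then have "{B \<in> insert (insert x S) P. x \<in> B} = {insert x S}" by auto
    then have "\<Union>{B \<in> ?i z. x \<in> B} = insert x S" by (simp add: z)
    moreover have "insert x S \<notin> P" using nx by blast
    ultimately show "?j (?i z) = z" using z assms(2) by auto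
  qed
  have "partition_sum \<kappa> (insert x A) = (\<Sum>(S, P)\<in>?I. \<kappa> (Suc (card S)) * (\<Prod>B\<in>P. \<kappa> (card B)))"
    unfolding partition_sum_def
    by (rule sum.reindex_bij_witness[where i = ?i and j = ?j]) (use i j in auto)
  then show ?thesis
    using assms(1) finitely_many_partition_on[of "A - _"]
    by (simp add: partition_sum_def sum_distrib_left sum.Sigma)
qed

lemma sum_Pow_card:
  assumes "finite A"
  shows "(\<Sum>S\<in>Pow A. g (card S)) = (\<Sum>j\<le>card A. real (card A choose j) * g j)"
proof -
  have "(\<Sum>S\<in>Pow A. g (card S)) = (\<Sum>j\<le>card A. \<Sum>S | S \<in> Pow A \<and> card S = j. g (card S))"
    using assms by (intro sum.group[symmetric]) (auto intro: card_mono)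
  also have "\<dots> = (\<Sum>j\<le>card A. real (card A choose j) * g j)"
    using n_subsets[OF assms] by (intro sum.cong) simp_all
  finally show ?thesis .
qed

lemma partition_sum_empty [simp]: "partition_sum \<kappa> {} = 1"
  by (simp add: partition_sum_def partition_on_empty)

text \<open>The recursion of \<open>partition_sum_insert\<close> involves cardinalities only, so an
  induction replaces the transport of partitions along a bijection.\<close>

lemma partition_sum_card:
  fixes A :: "nat set"
  shows "finite A \<Longrightarrow> partition_sum \<kappa> A = partition_sum \<kappa> {1..card A}"
proof (induction "card A" arbitrary: A rule: less_induct)
  case less
  show ?case
  proof (cases "card A")
    case 0
    then show ?thesis using less.prems by simp
  next
    case (Suc m)
    then obtain x C where A: "A = insert x C" "x \<notin> C" "card C = m"
      by (metis card_Suc_eq)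
    have *: "partition_sum \<kappa> (insert z D)
        = (\<Sum>S\<in>Pow D. \<kappa> (Suc (card S)) * partition_sum \<kappa> {1..m - card S})"
      if D: "finite D" "z \<notin> D" "card D = m" for z and D :: "nat set"
    proof -
      have "partition_sum \<kappa> (D - S) = partition_sum \<kappa> {1..m - card S}" if "S \<subseteq> D" for S
        using less.hyps[of "D - S"] D Suc card_Diff_subset[OF finite_subset[OF that D(1)] that] by simp
      then show ?thesis
        unfolding partition_sum_insert[OF D(1,2)] by (intro sum.cong) auto
    qed
    let ?g = "\<lambda>j. \<kappa> (Suc j) * partition_sum \<kappa> {1..m - j}"
    have "finite C" using A(1) less.prems by simp
    moreover have "{1..Suc m} = insert (Suc m) {1..m}" by auto
    ultimately have "partition_sum \<kappa> (insert x C) = partition_sum \<kappa> {1..Suc m}"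
      using *[of C x] *[of "{1..m}" "Suc m"] A(2,3) sum_Pow_card[of C ?g] sum_Pow_card[of "{1..m}" ?g] by simp
    then show ?thesis using A(1) Suc by simp
  qed
qed

text \<open>This is \<open>exp K\<close> for the cumulant generating function \<open>K\<close>; the
  differential equation below plays the part of that formula.\<close>

definition cumulant_egf :: "(nat \<Rightarrow> real) \<Rightarrow> real fps" where
  "cumulant_egf \<kappa> = Abs_fps (\<lambda>n. partition_sum \<kappa> {1..n} / fact n)"

lemma cumulant_egf_0 [simp]: "fps_nth (cumulant_egf \<kappa>) 0 = 1"
  by (simp add: cumulant_egf_def)

text \<open>Sorting by the block of \<open>Suc n\<close> gives a binomial recursion, which after
  division by \<open>fact n\<close> is a Cauchy product.\<close>

lemma fps_deriv_cumulant_egf: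
  "fps_deriv (cumulant_egf \<kappa>) = Abs_fps (\<lambda>n. \<kappa> (Suc n) / fact n) * cumulant_egf \<kappa>"
proof (rule fps_ext)
  fix n
  have eq: "{1..Suc n} = insert (Suc n) {1..n}" by auto
  have "partition_sum \<kappa> {1..Suc n} = (\<Sum>S\<in>Pow {1..n}. \<kappa> (Suc (card S)) * partition_sum \<kappa> {1..n - card S})"
    unfolding eq
  proof (subst partition_sum_insert, simp, simp, intro sum.cong refl arg_cong2[where f = "(*)"])
    fix S assume "S \<in> Pow {1..n}"
    then have "finite S" "S \<subseteq> {1..n}" using finite_subset by auto
    then show "partition_sum \<kappa> ({1..n} - S) = partition_sum \<kappa> {1..n - card S}"
      using partition_sum_card[of "{1..n} - S"] by (simp add: card_Diff_subset)
  qed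
  also have "\<dots> = (\<Sum>j\<le>n. real (n choose j) * (\<kappa> (Suc j) * partition_sum \<kappa> {1..n - j}))"
    using sum_Pow_card[of "{1..n}" "\<lambda>j. \<kappa> (Suc j) * partition_sum \<kappa> {1..n - j}"] by simp
  also have "\<dots> = fact n * (\<Sum>j\<le>n. (\<kappa> (Suc j) / fact j) * (partition_sum \<kappa> {1..n - j} / fact (n - j)))"
    unfolding sum_distrib_left by (intro sum.cong refl) (simp add: binomial_fact field_simps)
  finally have "partition_sum \<kappa> {1..Suc n} / fact n
    = (\<Sum>j\<le>n. (\<kappa> (Suc j) / fact j) * (partition_sum \<kappa> {1..n - j} / fact (n - j)))" by simp
  then show "fps_nth (fps_deriv (cumulant_egf \<kappa>)) n
    = fps_nth (Abs_fps (\<lambda>n. \<kappa> (Suc n) / fact n) * cumulant_egf \<kappa>) n"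
    by (simp add: cumulant_egf_def fps_mult_nth atLeast0AtMost field_simps del: of_nat_Suc)
qed

lemma fps_linear_ode_unique:
  fixes F G H :: "real fps"
  assumes "fps_deriv F = G * F" "fps_deriv H = G * H" "fps_nth F 0 = fps_nth H 0"
  shows "F = H"
proof (rule fps_ext)
  fix n show "fps_nth F n = fps_nth H n"
  proof (induction n rule: less_induct)
    case (less n)
    show ?case
    proof (cases n)
      case (Suc k)
      have "fps_nth (G * F) k = fps_nth (G * H) k"
        unfolding fps_mult_nth using less Suc by (intro sum.cong) auto
      then have "fps_nth (fps_deriv F) k = fps_nth (fps_deriv H) k" using assms by simp
      then show ?thesis using Suc by (simp del: of_nat_Suc)
    qed (use assms in simp)
  qed
qed

text \<open>By the Leibniz rule the product solves the equation for the summed cumulants, with the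
  same constant term.\<close>

lemma cumulant_egf_add: "cumulant_egf (\<lambda>l. \<kappa> l + \<kappa>' l) = cumulant_egf \<kappa> * cumulant_egf \<kappa>'"
proof (rule fps_linear_ode_unique[OF fps_deriv_cumulant_egf])
  have "Abs_fps (\<lambda>n. (\<kappa> (Suc n) + \<kappa>' (Suc n)) / fact n)
    = Abs_fps (\<lambda>n. \<kappa> (Suc n) / fact n) + Abs_fps (\<lambda>n. \<kappa>' (Suc n) / fact n)"
    by (simp add: fps_eq_iff add_divide_distrib)
  then show "fps_deriv (cumulant_egf \<kappa> * cumulant_egf \<kappa>')
    = Abs_fps (\<lambda>n. (\<kappa> (Suc n) + \<kappa>' (Suc n)) / fact n) * (cumulant_egf \<kappa> * cumulant_egf \<kappa>')"
    by (simp add: fps_deriv_cumulant_egf algebra_simps)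
qed simp

lemma partition_sum_add_cumulants:
  "partition_sum (\<lambda>l. \<kappa> l + \<kappa>' l) {1..k}
    = (\<Sum>i\<le>k. real (k choose i) * partition_sum \<kappa> {1..i} * partition_sum \<kappa>' {1..k - i})"
proof -
  have "partition_sum (\<lambda>l. \<kappa> l + \<kappa>' l) {1..k} = fact k * fps_nth (cumulant_egf (\<lambda>l. \<kappa> l + \<kappa>' l)) k"
    by (simp add: cumulant_egf_def)
  also have "\<dots> = (\<Sum>i\<le>k. fact k * (partition_sum \<kappa> {1..i} / fact i * (partition_sum \<kappa>' {1..k - i} / fact (k - i))))"
    unfolding cumulant_egf_add by (simp add: cumulant_egf_def fps_mult_nth atLeast0AtMost sum_distrib_left)
  also have "\<dots> = (\<Sum>i\<le>k. real (k choose i) * partition_sum \<kappa> {1..i} * partition_sum \<kappa>' {1..k - i})"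
    by (intro sum.cong refl) (simp add: binomial_fact field_simps)
  finally show ?thesis .
qed

text \<open>With \<open>w = 0\<close> a positive number of steps enters an even height only by a
  descent, so two steps act on the even heights as \<open>\<partial> + K'\<close>, which is
  \<open>\<partial>\<close> conjugated by \<open>exp K\<close>.\<close>

lemma path_sum_eq_partition_sum:
  fixes x :: "nat \<Rightarrow> real"
  defines "y \<equiv> \<lambda>p. x p / (2 ^ (p - 1) * fact (p - 1))"
  shows "path_sum (\<lambda>i. if even i then 1 else real (Suc i)) (two_step_weight y 0) (2 * k) 0
    = partition_sum x {1..k}"
proof -
  define F where "F = path_sum (\<lambda>i. if even i then 1 else real (Suc i)) (two_step_weight y 0)"
  \<comment> \<open>The factor \<open>2 ^ s\<close> turns the descent weight
    \<open>2 * Suc s\<close> into the \<open>Suc s\<close> of a derivative; the power of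
    \<open>2\<close> in \<open>y\<close> compensates for it in the ascents.\<close>
  define N where "N k = Abs_fps (\<lambda>s. 2 ^ s * F (2 * k) (2 * s))" for k
  let ?K = "Abs_fps (\<lambda>n. x (Suc n) / fact n)"
  have step: "F (2 * Suc k) (2 * s) = 2 * real (Suc s) * F (2 * k) (2 * Suc s)
    + (\<Sum>t\<le>s. y (Suc t) * F (2 * k) (2 * (s - t)))" for k s
  proof -
    \<comment> \<open>The last step is a descent of weight \<open>1\<close>: an odd ascent into
      \<open>2 * s\<close> would start at an odd height.\<close>
    have "F (2 * Suc k) (2 * s) = F (Suc (2 * k)) (Suc (2 * s))"
      unfolding F_def by (simp add: two_step_weight_def) (auto intro!: sum.neutral)
    also have "\<dots> = real (2 * Suc s) * F (2 * k) (2 * Suc s)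
      + (\<Sum>j\<le>Suc (2 * s). two_step_weight y 0 (Suc (2 * s) - j) j * F (2 * k) (Suc (2 * s) - j))"
      unfolding F_def by simp
    also have "(\<Sum>j\<le>Suc (2 * s). two_step_weight y 0 (Suc (2 * s) - j) j * F (2 * k) (Suc (2 * s) - j))
      = (\<Sum>j\<in>(\<lambda>t. Suc (2 * t)) ` {..s}. two_step_weight y 0 (Suc (2 * s) - j) j * F (2 * k) (Suc (2 * s) - j))"
      by (rule sum.mono_neutral_right) (auto simp: two_step_weight_def image_iff elim!: oddE)
    also have "\<dots> = (\<Sum>t\<le>s. y (Suc t) * F (2 * k) (2 * (s - t)))"
      by (subst sum.reindex) (auto simp: inj_on_def two_step_weight_def right_diff_distrib' intro!: sum.cong)
    finally show ?thesis by simp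
  qed
  have N0: "N 0 = 1"
    by (simp add: N_def F_def fps_eq_iff)
  have NS: "N (Suc k) = fps_deriv (N k) + ?K * N k" for k
  proof (rule fps_ext)
    fix s
    have "(2::real) ^ s = 2 ^ t * 2 ^ (s - t)" if "t \<le> s" for t
      using that by (simp flip: power_add)
    then have "2 ^ s * (\<Sum>t\<le>s. y (Suc t) * F (2 * k) (2 * (s - t)))
      = (\<Sum>t\<le>s. x (Suc t) / fact t * (2 ^ (s - t) * F (2 * k) (2 * (s - t))))"
      unfolding sum_distrib_left by (intro sum.cong refl) (simp add: y_def)
    then show "fps_nth (N (Suc k)) s = fps_nth (fps_deriv (N k) + ?K * N k) s"
      unfolding N_def fps_add_nth fps_mult_nth fps_nth_Abs_fps fps_deriv_nth step atLeast0AtMost distrib_left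
      by simp
  qed
  \<comment> \<open>Conjugation:
    \<open>\<partial>(exp K * N) = exp K * (\<partial> + K') N\<close>.\<close>
  have "cumulant_egf x * N k = (fps_deriv ^^ k) (cumulant_egf x)" for k
  proof (induction k)
    case (Suc k)
    have "cumulant_egf x * N (Suc k) = fps_deriv (cumulant_egf x * N k)"
      by (simp add: NS fps_deriv_cumulant_egf algebra_simps)
    then show ?case using Suc by simp
  qed (simp add: N0)
  then have "fps_nth (cumulant_egf x * N k) 0 = fact k * fps_nth (cumulant_egf x) k"
    by (simp add: fps_0th_higher_deriv)
  then show ?thesis by (simp add: N_def F_def cumulant_egf_def)
qed

section \<open>Moments of the convolution of two laws\<close>

lemma convolution_moments:
  assumes "has_moments M a" "has_moments N b"
  shows "integrable (M \<star> N) (\<lambda>x. x ^ k)"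
    and "(\<integral>x. x ^ k \<partial>(M \<star> N)) = (\<Sum>i\<le>k. real (k choose i) * a i * b (k - i))"
proof -
  from assms have M: "real_distribution M" "\<And>k. integrable M (\<lambda>x. x ^ k)" "\<And>k. (\<integral>x. x ^ k \<partial>M) = a k"
    and N: "real_distribution N" "\<And>k. integrable N (\<lambda>x. x ^ k)" "\<And>k. (\<integral>x. x ^ k \<partial>N) = b k"
    by (auto simp: has_moments_def)
  interpret M: real_distribution M by fact
  interpret N: real_distribution N by fact
  interpret pair_prob_space M N ..
  have int: "integrable (M \<Otimes>\<^sub>M N) (\<lambda>(x, y). x ^ i * y ^ j)" for i j
  proof (rule Fubini_integrable)
    show "integrable M (\<lambda>x. \<integral>y. norm (case (x, y) of (x, y) \<Rightarrow> x ^ i * y ^ j) \<partial>N)"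
      using M(2) by (simp add: abs_mult integrable_norm[of M "\<lambda>x. x ^ i", simplified])
  qed (use N(2) in auto)
  have eq: "(\<integral>z. (case z of (x, y) \<Rightarrow> x ^ i * y ^ j) \<partial>(M \<Otimes>\<^sub>M N)) = a i * b j" for i j
    using integral_fst'[OF int[of i j]] M(3) N(3) by simp
  have m: "(\<lambda>(x, y). x + y) \<in> M \<Otimes>\<^sub>M N \<rightarrow>\<^sub>M borel" by measurable
  have pow: "(case z of (x, y) \<Rightarrow> x + y) ^ k = (\<Sum>i\<le>k. real (k choose i) * (case z of (x, y) \<Rightarrow> x ^ i * y ^ (k - i)))"
    for z :: "real \<times> real"
    by (cases z) (simp add: binomial_ring mult_ac)
  have i: "integrable (M \<Otimes>\<^sub>M N) (\<lambda>z. (case z of (x, y) \<Rightarrow> x + y) ^ k)"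
    unfolding pow using int by (intro Bochner_Integration.integrable_sum integrable_mult_right)
  then show "integrable (M \<star> N) (\<lambda>x. x ^ k)"
    unfolding convolution_def by (simp add: integrable_distr_eq[OF m])
  have "(\<integral>x. x ^ k \<partial>(M \<star> N)) = (\<integral>z. (case z of (x, y) \<Rightarrow> x + y) ^ k \<partial>(M \<Otimes>\<^sub>M N))"
    unfolding convolution_def by (simp add: integral_distr[OF m])
  also have "\<dots> = (\<Sum>i\<le>k. real (k choose i) * a i * b (k - i))"
    unfolding pow using int eq by (subst Bochner_Integration.integral_sum) (auto simp: mult.assoc)
  finally show "(\<integral>x. x ^ k \<partial>(M \<star> N)) = (\<Sum>i\<le>k. real (k choose i) * a i * b (k - i))" .
qed

section \<open>Rescaled path sums\<close>

text \<open>Coefficient \<open>i\<close> is height \<open>i\<close>: the lowering operators give the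
  descent, multiplication by \<open>g\<close> the ascents.\<close>

lemma qg_op_funpow_nth:
  "fps_nth ((qg_op q \<gamma> g ^^ n) 1) i =
    path_sum (\<lambda>i. if even i then real i + 2 * q * \<gamma> else real i + 1 + 2 * \<gamma>) (\<lambda>_ j. fps_nth g j) n i"
  by (induction n arbitrary: i) (simp_all add: qg_op_nth)

text \<open>The lowering operators annihilate constants, so \<open>g\<close> is the operator applied
  to \<open>1\<close>; this supplies the step from \<open>2 * k - 1\<close> to
  \<open>2 * k\<close>.\<close>

lemma qg_moment_eq_path_sum:
  assumes "k \<ge> 1"
  shows "qg_moment q \<gamma> \<kappa> k =
    path_sum (\<lambda>i. if even i then real i + 2 * q * \<gamma> else real i + 1 + 2 * \<gamma>) (\<lambda>_ j. \<kappa> (Suc j)) (2 * k) 0"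
proof -
  let ?g = "cumulant_fps \<kappa>"
  have "qg_op q \<gamma> ?g 1 = ?g"
    by (rule fps_ext) (simp add: qg_op_def d_op_def d'_op_def)
  then have "(qg_op q \<gamma> ?g ^^ (2 * k - 1)) ?g = (qg_op q \<gamma> ?g ^^ Suc (2 * k - 1)) 1"
    by (simp only: funpow_Suc_right o_apply)
  also have "Suc (2 * k - 1) = 2 * k" using assms by simp
  finally show ?thesis
    unfolding qg_moment_def using qg_op_funpow_nth[where n = "2 * k" and i = 0] by (simp add: cumulant_fps_def)
qed

text \<open>Conjugation by a diagonal matrix: the factors \<open>B\<close> telescope along each
  path.\<close>

lemma path_sum_gauge:
  assumes "\<And>i. B i \<noteq> 0"
  shows "path_sum A W n i * B i =
    B 0 * path_sum (\<lambda>i. A i * B i / B (Suc i)) (\<lambda>h j. W h j * B (h + j) / B h) n i"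
proof (induction n arbitrary: i)
  case (Suc n)
  let ?P = "path_sum (\<lambda>i. A i * B i / B (Suc i)) (\<lambda>h j. W h j * B (h + j) / B h)"
  have P: "path_sum A W n i = B 0 * ?P n i / B i" for i
    using Suc[of i] assms[of i] by (simp add: field_simps)
  have "W (i - j) j * path_sum A W n (i - j) * B i
    = B 0 * (W (i - j) j * B (i - j + j) / B (i - j) * ?P n (i - j))" if "j \<le> i" for j
    using that by (simp add: P)
  then show ?case
    by (simp add: P distrib_right distrib_left sum_distrib_right sum_distrib_left mult_ac)
qed simp

lemma qg_moment_rescaled:
  assumes "k \<ge> 1" "\<alpha> > 0" "\<beta> > 0"
  shows "qg_moment q \<gamma> (\<lambda>l. if even l then c (l div 2) / (\<alpha> ^ (l div 2) * \<beta> ^ (l div 2 - 1)) else 0) k =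
    path_sum (\<lambda>i. if even i then (real i + 2 * q * \<gamma>) / \<alpha> else (real i + 1 + 2 * \<gamma>) / \<beta>)
      (two_step_weight c (\<beta> / \<alpha>)) (2 * k) 0"
proof -
  \<comment> \<open>One factor \<open>\<alpha>\<close> for each even and one \<open>\<beta>\<close>
    for each odd height below \<open>i\<close>. An ascent by \<open>2p - 1\<close> gains
    \<open>\<alpha> ^ p * \<beta> ^ (p - 1)\<close> from an even height, and
    \<open>\<beta> / \<alpha>\<close> times that from an odd one.\<close>
  define B where "B i = \<alpha> ^ (Suc i div 2) * \<beta> ^ (i div 2)" for i
  let ?a = "\<lambda>i. if even i then real i + 2 * q * \<gamma> else real i + 1 + 2 * \<gamma>"
  let ?\<kappa> = "\<lambda>l. if even l then c (l div 2) / (\<alpha> ^ (l div 2) * \<beta> ^ (l div 2 - 1)) else 0"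
  have B: "B i \<noteq> 0" for i using assms by (simp add: B_def)
  have "qg_moment q \<gamma> ?\<kappa> k = path_sum ?a (\<lambda>_ j. ?\<kappa> (Suc j)) (2 * k) 0 * B 0"
    using assms by (simp add: qg_moment_eq_path_sum B_def)
  also have "\<dots> = path_sum (\<lambda>i. ?a i * B i / B (Suc i)) (\<lambda>h j. ?\<kappa> (Suc j) * B (h + j) / B h) (2 * k) 0"
    using path_sum_gauge[of B ?a "\<lambda>_ j. ?\<kappa> (Suc j)" "2 * k" 0] B by (simp add: B_def)
  also have "\<dots> = path_sum (\<lambda>i. if even i then (real i + 2 * q * \<gamma>) / \<alpha> else (real i + 1 + 2 * \<gamma>) / \<beta>)
      (two_step_weight c (\<beta> / \<alpha>)) (2 * k) 0"
  proof (intro arg_cong2[where f = "\<lambda>A W. path_sum A W (2 * k) 0"] ext)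
    fix i
    show "?a i * B i / B (Suc i) = (if even i then (real i + 2 * q * \<gamma>) / \<alpha> else (real i + 1 + 2 * \<gamma>) / \<beta>)"
      using assms by (auto simp: B_def elim!: evenE oddE)
  next
    fix h j
    show "?\<kappa> (Suc j) * B (h + j) / B h = two_step_weight c (\<beta> / \<alpha>) h j"
    proof (cases "even j")
      case True
      then show ?thesis by (simp add: two_step_weight_def)
    next
      case False
      then obtain p where p: "j = 2 * p + 1" by (auto elim: oddE)
      show ?thesis
      proof (cases "even h")
        case True
        then obtain s where "h = 2 * s" by (auto elim: evenE)
        then show ?thesis using assms p by (simp add: B_def two_step_weight_def power_add)
      next
        case False
        then obtain s where "h = 2 * s + 1" by (auto elim: oddE)
        then show ?thesis using assms p by (simp add: B_def two_step_weight_def power_add field_simps)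
      qed
    qed
  qed
  finally show ?thesis .
qed

section \<open>Limits of path sums and their inversion\<close>

lemma path_sum_tendsto:
  assumes "\<And>i. ((\<lambda>t. A t i) \<longlongrightarrow> A' i) F" "\<And>h j. ((\<lambda>t. W t h j) \<longlongrightarrow> W' h j) F"
  shows "((\<lambda>t. path_sum (A t) (W t) n i) \<longlongrightarrow> path_sum A' W' n i) F"
proof (induction n arbitrary: i)
  case (Suc n)
  show ?case unfolding path_sum.simps
    by (intro tendsto_intros assms Suc)
qed simp

lemma two_step_weight_tendsto:
  assumes "\<And>p. p \<ge> 1 \<Longrightarrow> ((\<lambda>t. c t p) \<longlongrightarrow> x p) F" "(w \<longlongrightarrow> w') F"
  shows "((\<lambda>t. two_step_weight (c t) (w t) h j) \<longlongrightarrow> two_step_weight x w' h j) F"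
proof (cases "odd j")
  case True
  then have "Suc j div 2 \<ge> 1" by (auto elim!: oddE)
  then show ?thesis using True assms by (auto simp: two_step_weight_def intro!: tendsto_intros)
qed (simp add: two_step_weight_def)

text \<open>In \<open>n\<close> steps ending at \<open>i\<close> an ascent is at most
  \<open>i + n - 1\<close>, with equality only if it is the first step and descents follow; their
  weights form the product.\<close>

lemma path_sum_triangular:
  assumes "\<And>h j. j < N \<Longrightarrow> W h j = W' h j"
  shows "(i + n \<le> N \<longrightarrow> path_sum A W n i = path_sum A W' n i) \<and>
    (i + n = Suc N \<and> i \<le> N \<longrightarrow> path_sum A W n i - path_sum A W' n i = (\<Prod>t=i..<N. A t) * (W 0 N - W' 0 N))"
proof (induction n arbitrary: i)
  case 0
  then show ?case by auto
next
  case (Suc n)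
  have lower: "W (i - j) j * path_sum A W n (i - j) = W' (i - j) j * path_sum A W' n (i - j)"
    if "j \<le> i" "j < N" "i + n \<le> N" for j
    using Suc.IH[of "i - j"] assms[of j] that by auto
  show ?case
  proof (cases "n = 0")
    case True
    have "(\<Sum>j\<le>i. W (i - j) j * path_sum A W n (i - j)) = W 0 i" for W
      using True by (subst sum.remove[of _ i]) (auto intro!: sum.neutral)
    then show ?thesis using True assms[of i 0] by auto
  next
    case False
    have "(\<Sum>j\<le>i. W (i - j) j * path_sum A W n (i - j)) = (\<Sum>j\<le>i. W' (i - j) j * path_sum A W' n (i - j))"
      if "i + n \<le> N"
      using that False by (intro sum.cong refl lower) auto
    then show ?thesis
      using Suc.IH[of "Suc i"] False
      by (auto simp: prod.atLeast_Suc_lessThan simp flip: right_diff_distrib)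
  qed
qed

text \<open>Inverts the limit degree by degree: changing the top weight \<open>c t k\<close> changes the path sum of
  length \<open>2 * k\<close> by a factor whose limit does not vanish.\<close>

lemma path_sum_inverse_tendsto:
  assumes A: "\<And>i. ((\<lambda>t. A t i) \<longlongrightarrow> A' i) F" "\<And>i. A' i \<noteq> 0" and w: "(w \<longlongrightarrow> w') F"
    and m: "\<And>k. k \<ge> 1 \<Longrightarrow> ((\<lambda>t. path_sum (A t) (two_step_weight (c t) (w t)) (2 * k) 0) \<longlongrightarrow> m k) F"
    and x: "\<And>k. k \<ge> 1 \<Longrightarrow> path_sum A' (two_step_weight x w') (2 * k) 0 = m k"
  shows "k \<ge> 1 \<Longrightarrow> ((\<lambda>t. c t k) \<longlongrightarrow> x k) F"
proof (induction k rule: less_induct)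
  case (less k)
  \<comment> \<open>\<open>X\<close> keeps \<open>c\<close> below \<open>k\<close> and has the limit
    \<open>x\<close> at \<open>k\<close>: its path sum still tends to \<open>m k\<close>, and the
    difference isolates \<open>c t k - x k\<close>.\<close>
  define X where "X t j = (if 1 \<le> j \<and> j < k then c t j else x j)" for t j
  let ?P = "\<lambda>t. \<Prod>i=0..<2 * k - 1. A t i" and ?P' = "\<Prod>i=0..<2 * k - 1. A' i"
  let ?d = "\<lambda>t. path_sum (A t) (two_step_weight (c t) (w t)) (2 * k) 0
    - path_sum (A t) (two_step_weight (X t) (w t)) (2 * k) 0"
  have "((\<lambda>t. X t j) \<longlongrightarrow> x j) F" for j
    by (cases "1 \<le> j \<and> j < k") (use less in \<open>auto simp: X_def\<close>)
  then have "((\<lambda>t. path_sum (A t) (two_step_weight (X t) (w t)) (2 * k) 0) \<longlongrightarrow> m k) F"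
    unfolding x[OF less.prems, symmetric] by (intro path_sum_tendsto two_step_weight_tendsto A w)
  then have d: "(?d \<longlongrightarrow> 0) F"
    using tendsto_diff[OF m[OF less.prems]] by fastforce
  have dP: "?d t = ?P t * (c t k - x k)" for t
  proof -
    have "two_step_weight (c t) (w t) h j = two_step_weight (X t) (w t) h j" if "j < 2 * k - 1" for h j
      using that by (auto simp: two_step_weight_def X_def elim!: oddE)
    from path_sum_triangular[where N = "2 * k - 1" and i = 0 and n = "2 * k" and A = "A t"
        and W = "two_step_weight (c t) (w t)" and W' = "two_step_weight (X t) (w t)", OF this] less.prems
    show ?thesis by (simp add: two_step_weight_def X_def)
  qed
  have P: "(?P \<longlongrightarrow> ?P') F" "?P' \<noteq> 0" using A by (auto intro: tendsto_prod)
  have "((\<lambda>t. ?d t / ?P t + x k) \<longlongrightarrow> 0 / ?P' + x k) F"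
    by (intro tendsto_intros d P)
  \<comment> \<open>The product has a nonzero limit, hence is eventually nonzero and
    cancels.\<close>
  moreover have "eventually (\<lambda>t. ?d t / ?P t + x k = c t k) F"
    using tendsto_imp_eventually_ne[OF P] by eventually_elim (simp add: dP)
  ultimately show ?case by (auto elim: Lim_transform_eventually)
qed

lemma qg_cumulants_spec:
  assumes "q \<ge> 1" "\<gamma> > 0"
  shows "qg_cumulants q \<gamma> m 0 = 0" "odd l \<Longrightarrow> qg_cumulants q \<gamma> m l = 0"
    "k \<ge> 1 \<Longrightarrow> qg_moment q \<gamma> (qg_cumulants q \<gamma> m) k = m (2 * k)"
  using theI'[OF qg_cumulants_ex1[OF assms, of m]] unfolding qg_cumulants_def by blast+

text \<open>Shared by both regimes, which choose \<open>\<alpha>\<close> and \<open>\<beta>\<close>.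
  The moments do not depend on \<open>t\<close>, so path sum inversion yields the cumulants;
  rescaling is linear, so sums of cumulants converge too, and then their path sums.\<close>

lemma qg_limits:
  fixes q \<gamma> \<alpha> \<beta> :: "'t \<Rightarrow> real"
  assumes ev: "eventually (\<lambda>t. q t \<ge> 1 \<and> \<gamma> t > 0 \<and> \<alpha> t > 0 \<and> \<beta> t > 0) F"
    and A: "\<And>i. ((\<lambda>t. if even i then (real i + 2 * q t * \<gamma> t) / \<alpha> t
        else (real i + 1 + 2 * \<gamma> t) / \<beta> t) \<longlongrightarrow> A' i) F" "\<And>i. A' i \<noteq> 0"
    and w: "((\<lambda>t. \<beta> t / \<alpha> t) \<longlongrightarrow> w') F"
  shows qg_cumulants_tendsto: "\<And>m x p. (\<And>k. k \<ge> 1 \<Longrightarrow> path_sum A' (two_step_weight x w') (2 * k) 0 = m (2 * k)) \<Longrightarrow> p \<ge> 1 \<Longrightarrow>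
        ((\<lambda>t. \<alpha> t ^ p * \<beta> t ^ (p - 1) * qg_cumulants (q t) (\<gamma> t) m (2 * p)) \<longlongrightarrow> x p) F"
    and qg_conv_tendsto: "\<And>ma mb xa xb k. (\<And>k. k \<ge> 1 \<Longrightarrow> path_sum A' (two_step_weight xa w') (2 * k) 0 = ma (2 * k)) \<Longrightarrow>
        (\<And>k. k \<ge> 1 \<Longrightarrow> path_sum A' (two_step_weight xb w') (2 * k) 0 = mb (2 * k)) \<Longrightarrow> k \<ge> 1 \<Longrightarrow>
        ((\<lambda>t. qg_conv (q t) (\<gamma> t) ma mb (2 * k)) \<longlongrightarrow>
          path_sum A' (two_step_weight (\<lambda>p. xa p + xb p) w') (2 * k) 0) F"
proof -
  define A where "A t i = (if even i then (real i + 2 * q t * \<gamma> t) / \<alpha> t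
        else (real i + 1 + 2 * \<gamma> t) / \<beta> t)" for t i
  define c where "c m t p = \<alpha> t ^ p * \<beta> t ^ (p - 1) * qg_cumulants (q t) (\<gamma> t) m (2 * p)" for m t p
  have A_lim: "((\<lambda>t. A t i) \<longlongrightarrow> A' i) F" for i using A(1)[of i] by (simp add: A_def)
  have un: "qg_cumulants (q t) (\<gamma> t) m
      = (\<lambda>l. if even l then c m t (l div 2) / (\<alpha> t ^ (l div 2) * \<beta> t ^ (l div 2 - 1)) else 0)"
    if "q t \<ge> 1 \<and> \<gamma> t > 0 \<and> \<alpha> t > 0 \<and> \<beta> t > 0" for m t
    using that qg_cumulants_spec(2)[of "q t" "\<gamma> t"] by (auto simp: c_def fun_eq_iff)
  {
    fix m x p assume x: "\<And>k. k \<ge> 1 \<Longrightarrow> path_sum A' (two_step_weight x w') (2 * k) 0 = m (2 * k)"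
      and p: "p \<ge> (1 :: nat)"
    have "((\<lambda>t. c m t p) \<longlongrightarrow> x p) F"
    proof (rule path_sum_inverse_tendsto[OF A_lim A(2) w _ x p])
      fix k :: nat assume k: "k \<ge> 1"
      have "eventually (\<lambda>t. m (2 * k) = path_sum (A t) (two_step_weight (c m t) (\<beta> t / \<alpha> t)) (2 * k) 0) F"
        using ev
      proof eventually_elim
        case (elim t)
        have "m (2 * k) = qg_moment (q t) (\<gamma> t) (qg_cumulants (q t) (\<gamma> t) m) k"
          using qg_cumulants_spec(3) k elim by simp
        also have "\<dots> = path_sum (A t) (two_step_weight (c m t) (\<beta> t / \<alpha> t)) (2 * k) 0"
          unfolding un[OF elim] A_def using k elim by (intro qg_moment_rescaled) auto
        finally show ?case .
      qed
      then show "((\<lambda>t. path_sum (A t) (two_step_weight (c m t) (\<beta> t / \<alpha> t)) (2 * k) 0) \<longlongrightarrow> m (2 * k)) F"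
        by (rule Lim_transform_eventually[OF tendsto_const])
    qed
    note this[unfolded c_def]
  }
  note cum = this
  then show "\<And>m x p. (\<And>k. k \<ge> 1 \<Longrightarrow> path_sum A' (two_step_weight x w') (2 * k) 0 = m (2 * k)) \<Longrightarrow> p \<ge> 1 \<Longrightarrow>
        ((\<lambda>t. \<alpha> t ^ p * \<beta> t ^ (p - 1) * qg_cumulants (q t) (\<gamma> t) m (2 * p)) \<longlongrightarrow> x p) F" .
  fix ma mb :: "nat \<Rightarrow> real" and xa xb k
  assume xa: "\<And>k. k \<ge> 1 \<Longrightarrow> path_sum A' (two_step_weight xa w') (2 * k) 0 = ma (2 * k)"
    and xb: "\<And>k. k \<ge> 1 \<Longrightarrow> path_sum A' (two_step_weight xb w') (2 * k) 0 = mb (2 * k)" and k: "k \<ge> (1 :: nat)"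
  have "((\<lambda>t. path_sum (A t) (two_step_weight (\<lambda>p. c ma t p + c mb t p) (\<beta> t / \<alpha> t)) (2 * k) 0) \<longlongrightarrow>
          path_sum A' (two_step_weight (\<lambda>p. xa p + xb p) w') (2 * k) 0) F"
    unfolding c_def
    by (intro path_sum_tendsto two_step_weight_tendsto A_lim w tendsto_add cum xa xb)
  moreover have "eventually (\<lambda>t. path_sum (A t) (two_step_weight (\<lambda>p. c ma t p + c mb t p) (\<beta> t / \<alpha> t)) (2 * k) 0
     = qg_conv (q t) (\<gamma> t) ma mb (2 * k)) F"
    using ev
  proof eventually_elim
    case (elim t)
    have "(\<lambda>l. qg_cumulants (q t) (\<gamma> t) ma l + qg_cumulants (q t) (\<gamma> t) mb l)
      = (\<lambda>l. if even l then (c ma t (l div 2) + c mb t (l div 2)) / (\<alpha> t ^ (l div 2) * \<beta> t ^ (l div 2 - 1)) else 0)"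
      unfolding un[OF elim] by (auto simp: add_divide_distrib)
    then show ?case
      using qg_moment_rescaled[OF k, of "\<alpha> t" "\<beta> t" "q t" "\<gamma> t" "\<lambda>p. c ma t p + c mb t p"] elim k
      unfolding A_def by (simp add: qg_conv_def)
  qed
  ultimately show "((\<lambda>t. qg_conv (q t) (\<gamma> t) ma mb (2 * k)) \<longlongrightarrow>
          path_sum A' (two_step_weight (\<lambda>p. xa p + xb p) w') (2 * k) 0) F"
    by (rule Lim_transform_eventually)
qed

section \<open>The two regimes\<close>

lemma usual_cumulants_spec:
  assumes "k \<ge> 1"
  shows "partition_sum (usual_cumulants m) {1..k} = m (2 * k)"
  using theI'[OF usual_cumulants_ex1[of m]] assms
  unfolding usual_cumulants_def partition_sum_def by simp

lemma rect_free_cumulants_spec: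
  shows "odd l \<Longrightarrow> rect_free_cumulants q m l = 0"
    "k \<ge> 1 \<Longrightarrow> rect_free_moment q (rect_free_cumulants q m) k = m (2 * k)"
  using theI'[OF rect_free_cumulants_ex1[of q m]] unfolding rect_free_cumulants_def by blast+

section \<open>The classical regime, with \<open>\<alpha> = 2 * q * \<gamma>\<close> and
  \<open>\<beta> = 1\<close>\<close>

lemma classical_regime_limits:
  "eventually (\<lambda>t. fst t \<ge> 1 \<and> snd t > 0) classical_regime"
  "(snd \<longlongrightarrow> 0) classical_regime"
  "((\<lambda>t. 1 / (2 * fst t * snd t)) \<longlongrightarrow> 0) classical_regime"
proof -
  show ev: "eventually (\<lambda>t. fst t \<ge> 1 \<and> snd t > 0) classical_regime"
    unfolding eventually_classical_regime by (intro exI[of _ 1] conjI) auto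
  show "(snd \<longlongrightarrow> 0) classical_regime"
  proof (rule tendstoI)
    fix e :: real assume "e > 0"
    then show "eventually (\<lambda>t. dist (snd t) 0 < e) classical_regime"
      unfolding eventually_classical_regime by (intro exI[of _ e] conjI) auto
  qed
  have "filterlim (\<lambda>t. 2 * fst t * snd t) at_top classical_regime"
    unfolding filterlim_at_top_dense
  proof
    fix Z :: real
    show "eventually (\<lambda>t. Z < 2 * fst t * snd t) classical_regime"
      unfolding eventually_classical_regime
      by (intro exI[of _ 1] conjI exI[of _ "Z / 2"]) (auto simp: field_simps)
  qed
  then show "((\<lambda>t. 1 / (2 * fst t * snd t)) \<longlongrightarrow> 0) classical_regime"
    by (intro tendsto_divide_0[OF tendsto_const] filterlim_at_top_imp_at_infinity)
qed

text \<open>The value \<open>\<beta> = 1\<close> stays explicit so that both facts match the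
  hypotheses of \<open>qg_limits\<close>.\<close>

lemma classical_regime_weights:
  "eventually (\<lambda>t. fst t \<ge> 1 \<and> snd t > 0 \<and> 2 * fst t * snd t > 0 \<and> (1 :: real) > 0) classical_regime"
  "((\<lambda>t. if even i then (real i + 2 * fst t * snd t) / (2 * fst t * snd t) else (real i + 1 + 2 * snd t) / 1)
    \<longlongrightarrow> (if even i then 1 else real (Suc i))) classical_regime"
proof -
  note lim = classical_regime_limits
  show "eventually (\<lambda>t. fst t \<ge> 1 \<and> snd t > 0 \<and> 2 * fst t * snd t > 0 \<and> (1 :: real) > 0) classical_regime"
    using lim(1) by eventually_elim auto
  show "((\<lambda>t. if even i then (real i + 2 * fst t * snd t) / (2 * fst t * snd t) else (real i + 1 + 2 * snd t) / 1)
    \<longlongrightarrow> (if even i then 1 else real (Suc i))) classical_regime"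
  proof (cases "even i")
    case True
    have "((\<lambda>t. real i * (1 / (2 * fst t * snd t)) + 1) \<longlongrightarrow> real i * 0 + 1) classical_regime"
      by (intro tendsto_intros lim)
    moreover have "eventually (\<lambda>t. real i * (1 / (2 * fst t * snd t)) + 1
        = (real i + 2 * fst t * snd t) / (2 * fst t * snd t)) classical_regime"
      using lim(1) by eventually_elim (auto simp: field_simps)
    ultimately show ?thesis using True by (auto elim: Lim_transform_eventually)
  next
    case False
    have "((\<lambda>t. (real i + 1 + 2 * snd t) / 1) \<longlongrightarrow> (real i + 1 + 2 * 0) / 1) classical_regime"
      by (intro tendsto_intros lim) auto
    then show ?thesis using False by (simp add: add_ac)
  qed
qed

lemma path_sum_usual_cumulants:
  "k \<ge> 1 \<Longrightarrow> path_sum (\<lambda>i. if even i then 1 else real (Suc i))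
    (two_step_weight (\<lambda>p. usual_cumulants m p / (2 ^ (p - 1) * fact (p - 1))) 0) (2 * k) 0 = m (2 * k)"
  unfolding path_sum_eq_partition_sum by (rule usual_cumulants_spec)

text \<open>The factor \<open>2 ^ (p - 1) * fact (p - 1)\<close> cancels the normalisation in
  \<open>path_sum_eq_partition_sum\<close>.\<close>

lemma classical_qg_cumulants:
  assumes "p \<ge> 1"
  shows "((\<lambda>t. (2 * fst t * snd t) ^ p * (2 ^ (p - 1) * fact (p - 1)) * qg_cumulants (fst t) (snd t) m (2 * p))
    \<longlongrightarrow> usual_cumulants m p) classical_regime"
proof -
  have "((\<lambda>t. (2 * fst t * snd t) ^ p * 1 ^ (p - 1) * qg_cumulants (fst t) (snd t) m (2 * p))
    \<longlongrightarrow> usual_cumulants m p / (2 ^ (p - 1) * fact (p - 1))) classical_regime"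
    by (rule qg_cumulants_tendsto[OF classical_regime_weights _ classical_regime_limits(3)
        path_sum_usual_cumulants assms]) auto
  from tendsto_mult_left[OF this, of "2 ^ (p - 1) * fact (p - 1)"] show ?thesis
    by (simp add: mult_ac)
qed

lemma classical_qg_conv:
  assumes "k \<ge> 1"
  shows "((\<lambda>t. qg_conv (fst t) (snd t) ma mb (2 * k))
    \<longlongrightarrow> partition_sum (\<lambda>l. usual_cumulants ma l + usual_cumulants mb l) {1..k}) classical_regime"
proof -
  have "((\<lambda>t. qg_conv (fst t) (snd t) ma mb (2 * k)) \<longlongrightarrow>
    path_sum (\<lambda>i. if even i then 1 else real (Suc i)) (two_step_weight
      (\<lambda>p. usual_cumulants ma p / (2 ^ (p - 1) * fact (p - 1)) + usual_cumulants mb p / (2 ^ (p - 1) * fact (p - 1))) 0)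
      (2 * k) 0) classical_regime"
    by (rule qg_conv_tendsto[OF classical_regime_weights _ classical_regime_limits(3)
        path_sum_usual_cumulants path_sum_usual_cumulants assms]) auto
  then show ?thesis
    unfolding add_divide_distrib[symmetric] path_sum_eq_partition_sum .
qed

section \<open>The free regime, with \<open>\<alpha> = 2 * q * \<gamma>\<close> and
  \<open>\<beta> = 2 * \<gamma>\<close>\<close>

lemma free_weights:
  fixes q :: real
  assumes "q \<ge> 1"
  shows "eventually (\<lambda>\<gamma>. q \<ge> 1 \<and> \<gamma> > 0 \<and> 2 * q * \<gamma> > 0 \<and> 2 * \<gamma> > 0) at_top"
    "((\<lambda>\<gamma>. if even i then (real i + 2 * q * \<gamma>) / (2 * q * \<gamma>) else (real i + 1 + 2 * \<gamma>) / (2 * \<gamma>)) \<longlongrightarrow> 1) at_top"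
    "((\<lambda>\<gamma>. 2 * \<gamma> / (2 * q * \<gamma>)) \<longlongrightarrow> 1 / q) at_top"
proof -
  have q: "q > 0" using assms by simp
  have pos: "eventually (\<lambda>\<gamma>::real. \<gamma> > 0) at_top" by (rule eventually_gt_at_top)
  then show "eventually (\<lambda>\<gamma>. q \<ge> 1 \<and> \<gamma> > 0 \<and> 2 * q * \<gamma> > 0 \<and> 2 * \<gamma> > 0) at_top"
    by eventually_elim (use assms in auto)
  have ratio: "((\<lambda>\<gamma>. (a + b * \<gamma>) / (b * \<gamma>)) \<longlongrightarrow> 1) at_top" if b: "b > 0" for a b :: real
  proof -
    have "((\<lambda>\<gamma>. a / b * inverse \<gamma> + 1) \<longlongrightarrow> a / b * 0 + 1) at_top"
      by (intro tendsto_intros tendsto_inverse_0_at_top filterlim_ident)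
    moreover have "eventually (\<lambda>\<gamma>. a / b * inverse \<gamma> + 1 = (a + b * \<gamma>) / (b * \<gamma>)) at_top"
      using pos by eventually_elim (use b in \<open>auto simp: field_simps\<close>)
    ultimately show ?thesis by (auto elim: Lim_transform_eventually)
  qed
  show "((\<lambda>\<gamma>. if even i then (real i + 2 * q * \<gamma>) / (2 * q * \<gamma>) else (real i + 1 + 2 * \<gamma>) / (2 * \<gamma>)) \<longlongrightarrow> 1) at_top"
    using ratio[of "2 * q" "real i"] ratio[of 2 "real i + 1"] q by (cases "even i") auto
  have "eventually (\<lambda>\<gamma>. 1 / q = 2 * \<gamma> / (2 * q * \<gamma>)) at_top"
    using pos by eventually_elim (use q in auto)
  then show "((\<lambda>\<gamma>. 2 * \<gamma> / (2 * q * \<gamma>)) \<longlongrightarrow> 1 / q) at_top"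
    by (rule Lim_transform_eventually[OF tendsto_const])
qed

lemma rect_free_even:
  "(\<lambda>l. if even l then rect_free_cumulants q m (2 * (l div 2)) else 0) = rect_free_cumulants q m"
  by (auto simp: fun_eq_iff rect_free_cumulants_spec)

lemma path_sum_rect_free_cumulants:
  "k \<ge> 1 \<Longrightarrow> path_sum (\<lambda>_. 1) (two_step_weight (\<lambda>p. rect_free_cumulants q m (2 * p)) (1 / q)) (2 * k) 0 = m (2 * k)"
  unfolding path_sum_eq_rect_free_moment rect_free_even by (rule rect_free_cumulants_spec)

lemma free_qg_cumulants:
  assumes "q \<ge> 1" "p \<ge> 1"
  shows "((\<lambda>\<gamma>. (2 * q * \<gamma>) ^ p * (2 * \<gamma>) ^ (p - 1) * qg_cumulants q \<gamma> m (2 * p))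
    \<longlongrightarrow> rect_free_cumulants q m (2 * p)) at_top"
  by (rule qg_cumulants_tendsto[where q = "\<lambda>_. q" and \<gamma> = "\<lambda>\<gamma>. \<gamma>" and x = "\<lambda>p. rect_free_cumulants q m (2 * p)",
        OF free_weights(1,2)[OF assms(1)] _ free_weights(3)[OF assms(1)] path_sum_rect_free_cumulants assms(2)]) auto

lemma free_qg_conv:
  assumes "q \<ge> 1"
  shows "((\<lambda>\<gamma>. qg_conv q \<gamma> ma mb k) \<longlongrightarrow> rect_free_conv q ma mb k) at_top"
proof (cases "k = 0 \<or> odd k")
  case True
  then show ?thesis by (auto simp: qg_conv_def rect_free_conv_def)
next
  case False
  then obtain p where p: "k = 2 * p" "p \<ge> 1" by (auto elim!: evenE)
  have "((\<lambda>\<gamma>. qg_conv q \<gamma> ma mb (2 * p)) \<longlongrightarrow> path_sum (\<lambda>_. 1) (two_step_weight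
      (\<lambda>p. rect_free_cumulants q ma (2 * p) + rect_free_cumulants q mb (2 * p)) (1 / q)) (2 * p) 0) at_top"
    by (rule qg_conv_tendsto[where q = "\<lambda>_. q" and \<gamma> = "\<lambda>\<gamma>. \<gamma>",
        OF free_weights(1,2)[OF assms(1)] _ free_weights(3)[OF assms(1)] path_sum_rect_free_cumulants path_sum_rect_free_cumulants p(2)]) auto
  moreover have "(\<lambda>l. if even l then rect_free_cumulants q ma (2 * (l div 2)) + rect_free_cumulants q mb (2 * (l div 2)) else 0)
    = (\<lambda>l. rect_free_cumulants q ma l + rect_free_cumulants q mb l)"
    by (auto simp: fun_eq_iff rect_free_cumulants_spec)
  ultimately show ?thesis
    using p unfolding path_sum_eq_rect_free_moment by (simp add: rect_free_conv_def)
qed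

text \<open>The laws may fail to be determined by their moments, but the moments of their
  convolution depend on \<open>ma\<close> and \<open>mb\<close> alone.\<close>

lemma convolution_moments_partition_sum:
  assumes "corresponding_dist M ma" "corresponding_dist N mb"
  shows "(\<integral>x. x ^ k \<partial>(M \<star> N)) = partition_sum (\<lambda>l. usual_cumulants ma l + usual_cumulants mb l) {1..k}"
proof -
  have u: "partition_sum (usual_cumulants m) {1..i} = m (2 * i)" if "corresponding_dist \<mu> m" for \<mu> m i
  proof (cases "i = 0")
    \<comment> \<open>The end terms of the binomial sum need \<open>m 0 = 1\<close>, which is the
      total mass of the law.\<close>
    case True
    interpret real_distribution \<mu> using that by (simp add: corresponding_dist_def has_moments_def)
    have "(\<integral>x. x ^ 0 \<partial>\<mu>) = m (2 * 0)" using that unfolding corresponding_dist_def has_moments_def by blast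
    then show ?thesis using True prob_space by simp
  qed (simp add: usual_cumulants_spec[unfolded One_nat_def])
  show ?thesis
    using convolution_moments(2)[of M _ N, of "\<lambda>k. ma (2 * k)" "\<lambda>k. mb (2 * k)" k] assms
    by (simp add: partition_sum_add_cumulants u[OF assms(1)] u[OF assms(2)] corresponding_dist_def del: One_nat_def)
qed

theorem theorem1p14:
  shows "\<exists>r s :: nat \<Rightarrow> real \<Rightarrow> real \<Rightarrow> real.
    (\<forall>l\<ge>1. \<forall>q\<ge>1. \<forall>\<gamma>>0. r l q \<gamma> > 0 \<and> s l q \<gamma> > 0) \<and>
    (\<forall>ma mb :: nat \<Rightarrow> real.
      moment_seq ma \<and> moment_seq mb \<and> (\<forall>k. odd k \<longrightarrow> ma k = 0 \<and> mb k = 0) \<longrightarrow>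
        (\<forall>\<mu>a \<mu>b. corresponding_dist \<mu>a ma \<and> corresponding_dist \<mu>b mb \<longrightarrow>
          (\<forall>k. integrable (\<mu>a \<star> \<mu>b) (\<lambda>x. x ^ k) \<and>
            ((\<lambda>(q, \<gamma>). qg_conv q \<gamma> ma mb (2 * k)) \<longlongrightarrow> (\<integral>x. x ^ k \<partial>(\<mu>a \<star> \<mu>b))) classical_regime)) \<and>
        (\<forall>m\<in>{ma, mb}. \<forall>l\<ge>1.
          ((\<lambda>(q, \<gamma>). r (2 * l) q \<gamma> * qg_cumulants q \<gamma> m (2 * l)) \<longlongrightarrow> usual_cumulants m l)
            classical_regime) \<and>
        (\<forall>q\<ge>1.
          (\<forall>k. ((\<lambda>\<gamma>. qg_conv q \<gamma> ma mb k) \<longlongrightarrow> rect_free_conv q ma mb k) at_top) \<and>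
          (\<forall>m\<in>{ma, mb}. \<forall>l\<ge>1.
            ((\<lambda>\<gamma>. s l q \<gamma> * qg_cumulants q \<gamma> m l) \<longlongrightarrow> rect_free_cumulants q m l) at_top)))"
proof -
  \<comment> \<open>At index \<open>2p\<close> both factors contain
    \<open>\<alpha> ^ p * \<beta> ^ (p - 1)\<close>: \<open>r\<close> has \<open>\<beta> = 1\<close>
    and the normalisation of the usual cumulants, \<open>s\<close> has
    \<open>\<beta> = 2 * \<gamma>\<close>.\<close>
  define r where "r l q \<gamma> = (2 * q * \<gamma>) ^ (l div 2) * (2 ^ (l div 2 - 1) * fact (l div 2 - 1))"
    for l :: nat and q \<gamma> :: real
  define s where "s l q \<gamma> = (2 * q * \<gamma>) ^ (l div 2) * (2 * \<gamma>) ^ (l div 2 - 1)" for l :: nat and q \<gamma> :: real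
  have pos: "r l q \<gamma> > 0 \<and> s l q \<gamma> > 0" if "q \<ge> 1" "\<gamma> > 0" for l q \<gamma>
    using that by (simp add: r_def s_def)
  have usual_conv: "integrable (\<mu>a \<star> \<mu>b) (\<lambda>x. x ^ k) \<and>
      ((\<lambda>(q, \<gamma>). qg_conv q \<gamma> ma mb (2 * k)) \<longlongrightarrow> (\<integral>x. x ^ k \<partial>(\<mu>a \<star> \<mu>b))) classical_regime"
    if \<mu>: "corresponding_dist \<mu>a ma" "corresponding_dist \<mu>b mb" for \<mu>a \<mu>b ma mb k
  proof
    show "integrable (\<mu>a \<star> \<mu>b) (\<lambda>x. x ^ k)"
      using \<mu> convolution_moments(1) by (auto simp: corresponding_dist_def)
    show "((\<lambda>(q, \<gamma>). qg_conv q \<gamma> ma mb (2 * k)) \<longlongrightarrow> (\<integral>x. x ^ k \<partial>(\<mu>a \<star> \<mu>b))) classical_regime"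
    proof (cases "k = 0")
      case True
      then show ?thesis
        unfolding convolution_moments_partition_sum[OF \<mu>] by (simp add: qg_conv_def case_prod_unfold)
    next
      case False
      then show ?thesis
        unfolding convolution_moments_partition_sum[OF \<mu>] case_prod_unfold by (intro classical_qg_conv) simp
    qed
  qed
  have usual_cum: "((\<lambda>(q, \<gamma>). r (2 * l) q \<gamma> * qg_cumulants q \<gamma> m (2 * l)) \<longlongrightarrow> usual_cumulants m l) classical_regime"
    if "l \<ge> 1" for m l
    using classical_qg_cumulants[OF that, of m] by (simp add: r_def case_prod_unfold)
  have free_cum: "((\<lambda>\<gamma>. s l q \<gamma> * qg_cumulants q \<gamma> m l) \<longlongrightarrow> rect_free_cumulants q m l) at_top"
    if "q \<ge> 1" "l \<ge> 1" for q m l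
  proof (cases "even l")
    case True
    then obtain p where "l = 2 * p" "p \<ge> 1" using \<open>l \<ge> 1\<close> by (auto elim!: evenE)
    then show ?thesis using free_qg_cumulants[OF \<open>q \<ge> 1\<close>, of p m] by (simp add: s_def)
  next
    case False
    \<comment> \<open>At an odd index both cumulants vanish as soon as
      \<open>\<gamma> > 0\<close>.\<close>
    have "eventually (\<lambda>\<gamma>. rect_free_cumulants q m l = s l q \<gamma> * qg_cumulants q \<gamma> m l) at_top"
      using eventually_gt_at_top[of 0]
      by eventually_elim (use False that in \<open>simp add: rect_free_cumulants_spec qg_cumulants_spec\<close>)
    then show ?thesis by (rule Lim_transform_eventually[OF tendsto_const])
  qed
  show ?thesis
    by (intro exI[of _ r] exI[of _ s] conjI allI impI ballI)
       (elim conjE | assumption | rule pos[THEN conjunct1] pos[THEN conjunct2] usual_conv[THEN conjunct1]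
          usual_conv[THEN conjunct2] usual_cum free_qg_conv free_cum)+
qed

end
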